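(* Let $p$ be a prime with $p\equiv1\pmod3$ and let $K_p$ be the cyclic cubic subfield of $\mathbb Q(\zeta_p)$. Then $$\nu_j:=\frac{\sqrt p}{2^m s_j}\in K_p\qquad(j=0,1,2).$$
   Context: For a prime $p\equiv1\pmod3$ put $\zeta_p=e^{2\pi i/p}$ and $m=(p-1)/6$, and let $C_0,C_1,C_2$ be the three cosets of the subgroup of nonzero cubic residues in $(\mathbb Z/p\mathbb Z)^\times$. Put $$C_j^+=\{a\in\mathbb Z:1\le a<p/2,\ a\bmod p\in C_j\},\qquad s_j=\prod_{a\in C_j^+}\sin(\pi a/p).$$ $K_p$ is the unique subfield of $\mathbb Q(\zeta_p)\subset\mathbb C$ of degree 3 over $\mathbb Q$, and $\sqrt p>0$. *)

theory Defs
  imports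
    Complex_Main
    "HOL-Algebra.Generated_Fields"
    "HOL-Algebra.Embedded_Algebras"
    "HOL-Algebra.Algebraic_Closure_Type"
    "HOL-Number_Theory.Number_Theory"
begin

text \<open>
  The complex numbers as an object of HOL-Algebra, so that subfields, generated fields and
  degrees can be taken from there.
\<close>

definition complex_ring :: "complex ring" where
  "complex_ring = ring_of_type_algebra"

definition zeta :: "nat \<Rightarrow> complex" where
  "zeta p = exp (2 * of_real pi * \<i> / of_nat p)"

text \<open>
  A field generated by a set in a field of characteristic 0 contains the rationals, so this is
  the extension of the rationals by \<open>zeta p\<close>.
\<close>

definition cyclotomic_field :: "nat \<Rightarrow> complex set" where
  "cyclotomic_field p = generate_field complex_ring {zeta p}"

text \<open>
  Here \<open>ring.dimension R n F E\<close> says that \<open>E\<close> has dimension \<open>n\<close> over \<open>F\<close>. The description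
  operator is meaningful only where the subfield exists and is unique, as is the case for primes
  congruent to 1 modulo 3.
\<close>

definition cubic_subfield :: "nat \<Rightarrow> complex set" where
  "cubic_subfield p =
     (THE K. subfield K complex_ring \<and> K \<subseteq> cyclotomic_field p \<and>
             ring.dimension complex_ring 3 \<rat> K)"

text \<open>The elements of this group are the integers \<open>1, \<dots>, p - 1\<close> when \<open>p\<close> is prime.\<close>

definition residue_units :: "nat \<Rightarrow> int monoid" where
  "residue_units p = units_of (residue_ring (int p))"

definition cubic_residues :: "nat \<Rightarrow> int set" where
  "cubic_residues p =
     (\<lambda>x. x [^]\<^bsub>residue_units p\<^esub> (3::nat)) ` carrier (residue_units p)"

definition cubic_cosets :: "nat \<Rightarrow> int set set" where
  "cubic_cosets p = rcosets\<^bsub>residue_units p\<^esub> (cubic_residues p)"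

definition half_coset :: "nat \<Rightarrow> int set \<Rightarrow> int set" where
  "half_coset p C = {a. 1 \<le> a \<and> real_of_int a < real p / 2 \<and> a mod int p \<in> C}"

definition sine_product :: "nat \<Rightarrow> int set \<Rightarrow> real" where
  "sine_product p C = (\<Prod>a\<in>half_coset p C. sin (pi * real_of_int a / real p))"

text \<open>
  The division by 6 is exact for a prime \<open>p\<close> congruent to 1 modulo 3, since such a prime is odd.
\<close>

definition nu :: "nat \<Rightarrow> int set \<Rightarrow> real" where
  "nu p C = sqrt (real p) / (2 ^ ((p - 1) div 6) * sine_product p C)"

end

theory Submission
  imports Defs
begin

text \<open>
  Write \<open>\<zeta> = zeta p\<close> and \<open>p = 6 * m + 1\<close>, and fix a primitive root \<open>g\<close> modulo \<open>p\<close>. Let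
  \<open>\<delta>(n) = \<zeta>\<^bsup>-n/2\<^esup> - \<zeta>\<^bsup>n/2\<^esup>\<close>, where \<open>1/2\<close> is the inverse of 2 modulo \<open>p\<close>; its absolute value is
  \<open>2 |sin (\<pi> n / p)|\<close>, and \<open>\<delta>(-n) = -\<delta>(n)\<close>. Because \<open>g\<^bsup>3m\<^esup> = -1\<close> modulo \<open>p\<close>, the coset of \<open>g\<^sup>j\<close> consists
  of the residues \<open>\<plusminus>g\<^bsup>3k+j\<^esup>\<close> with \<open>k < m\<close>. So for
  \<open>H\<^sub>j = \<Prod>\<^sub>k\<^sub><\<^sub>m \<delta>(g\<^bsup>3k+j\<^esup>)\<close>, which is \<open>half_norm j\<close> below, \<open>2\<^sup>m s\<^sub>j = |H\<^sub>j|\<close>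
  (\<open>sine_product_cubic_class\<close>). Moreover \<open>|H\<^sub>0 H\<^sub>1 H\<^sub>2| = \<surd>p\<close>, since \<open>\<Prod>(1 - \<zeta>\<^sup>k) = p\<close>
  (\<open>norm_prod_half_norm\<close>). Hence \<open>\<nu>\<^sub>j\<close> is the absolute value of the product of the two \<open>H\<^sub>i\<close> with
  \<open>i \<noteq> j\<close>.

  Let \<open>\<sigma>\<close> be the automorphism \<open>\<zeta> \<mapsto> \<zeta>\<^sup>g\<close>, called \<open>galois\<close> below. It maps \<open>H\<^sub>j\<close> to \<open>H\<^sub>j\<^sub>+\<^sub>1\<close>, and
  \<open>H\<^sub>j\<^sub>+\<^sub>3 = -H\<^sub>j\<close>, because a shift by 3 trades the factor \<open>\<delta>(g\<^sup>j)\<close> for \<open>\<delta>(-g\<^sup>j)\<close>. So \<open>\<sigma>\<^sup>3\<close> fixes every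
  product \<open>H\<^sub>i H\<^sub>j\<close>. Such a product is real, as the \<open>\<delta>(n)\<close> are purely imaginary, and therefore \<open>\<nu>\<^sub>j\<close>,
  which equals it up to sign, lies in the fixed field of \<open>\<sigma>\<^sup>3\<close> (\<open>nu_in_fixed_field\<close>).

  It remains to identify this fixed field with the unique cubic subfield (\<open>cubic_subfield_eq\<close>).
  Eisenstein's criterion shows that \<open>\<zeta>\<close> has degree \<open>p - 1\<close>, which makes \<open>\<sigma>\<close> well defined and the
  conjugates \<open>\<zeta>\<^bsup>g\<^sup>n\<^esup>\<close> a rational basis of the cyclotomic field. For \<open>d\<close> dividing \<open>p - 1\<close>, the fixed field of
  \<open>\<sigma>\<^sup>d\<close> then has the \<open>d\<close> Gaussian periods as a basis (\<open>fixed_field_dimension\<close>). Conversely an element of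
  any cubic subfield has at most three conjugates, so it is fixed by \<open>\<sigma>\<^sup>2\<close> or by \<open>\<sigma>\<^sup>3\<close>; as a group is
  not the union of two proper subgroups, one of the two powers fixes the whole subfield, and for
  dimension reasons it is \<open>\<sigma>\<^sup>3\<close> (\<open>cubic_subfield_unique\<close>).
\<close>

section \<open>Roots of Eisenstein polynomials\<close>

text \<open>
  Comparing coefficients of \<open>F * G\<close> from the bottom up: as long as the coefficients of the product
  are divisible by \<open>q\<close>, an invertible constant term of \<open>G\<close> modulo \<open>q\<close> passes the divisibility on to
  the coefficients of \<open>F\<close>.
\<close>

lemma eisenstein_dvd_step:
  fixes F G :: "int poly" and q :: int
  assumes q: "Factorial_Ring.prime q"
    and lower: "\<And>i. i < n \<Longrightarrow> q dvd poly.coeff (F * G) i"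
    and G0: "\<not> q dvd poly.coeff G 0"
  shows "i < n \<Longrightarrow> q dvd poly.coeff F i"
proof (induction i rule: less_induct)
  case (less i)
  have "poly.coeff (F * G) i
      = (\<Sum>k<i. poly.coeff F k * poly.coeff G (i - k)) + poly.coeff F i * poly.coeff G 0"
    by (simp add: coeff_mult lessThan_Suc_atMost[symmetric])
  moreover have "q dvd (\<Sum>k<i. poly.coeff F k * poly.coeff G (i - k))"
    using less by (intro dvd_sum dvd_mult2) auto
  ultimately have "q dvd poly.coeff F i * poly.coeff G 0"
    using lower[OF less.prems] by (metis dvd_add_right_iff)
  thus ?case using q G0 prime_dvd_mult_iff by blast
qed

text \<open>
  Eisenstein's argument. Since \<open>q\<^sup>2\<close> does not divide the constant term of the product, one of the two
  constant terms is prime to \<open>q\<close>. If both factors had positive degree, the previous lemma would then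
  make \<open>q\<close> divide the leading coefficient of the other factor, although it is a unit.
\<close>

lemma eisenstein_degree:
  fixes F G :: "int poly" and q :: int
  assumes q: "Factorial_Ring.prime q"
    and monic: "Polynomial.lead_coeff (F * G) = 1"
    and lower: "\<And>i. i < Polynomial.degree (F * G) \<Longrightarrow> q dvd poly.coeff (F * G) i"
    and const: "\<not> q ^ 2 dvd poly.coeff (F * G) 0"
    and degF: "Polynomial.degree F > 0"
  shows "Polynomial.degree G = 0"
proof (rule ccontr)
  assume degG: "Polynomial.degree G \<noteq> 0"
  have nz: "F \<noteq> 0" "G \<noteq> 0" using degF degG by auto
  have deg: "Polynomial.degree (F * G) = Polynomial.degree F + Polynomial.degree G"
    using nz by (rule degree_mult_eq)
  have lc: "Polynomial.lead_coeff F * Polynomial.lead_coeff G = 1"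
    using monic by (simp add: lead_coeff_mult)
  have "\<not> is_unit q" using q by auto
  hence lcF: "\<not> q dvd Polynomial.lead_coeff F" and lcG: "\<not> q dvd Polynomial.lead_coeff G"
    using lc by (metis dvd_mult2 , metis dvd_mult)
  have "\<not> (q dvd poly.coeff F 0 \<and> q dvd poly.coeff G 0)"
    using const by (auto simp: coeff_mult power2_eq_square intro: mult_dvd_mono)
  thus False
  proof (elim notE, intro conjI)
    show "q dvd poly.coeff F 0"
    proof (rule ccontr)
      assume "\<not> q dvd poly.coeff F 0"
      with eisenstein_dvd_step[OF q, where F = G and G = F] lower
      have "q dvd Polynomial.lead_coeff G"
        using deg degF by (metis mult.commute less_add_same_cancel2)
      with lcG show False by contradiction
    qed
    show "q dvd poly.coeff G 0"
    proof (rule ccontr)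
      assume "\<not> q dvd poly.coeff G 0"
      with eisenstein_dvd_step[OF q, where F = F and G = G] lower
      have "q dvd Polynomial.lead_coeff F"
        using deg degG by (metis bot_nat_0.not_eq_extremum less_add_same_cancel1)
      with lcF show False by contradiction
    qed
  qed
qed

lemma map_poly_of_int_add:
  "map_poly of_int (f + g) = (map_poly of_int f + map_poly of_int g :: 'a::ring_1 poly)"
  by (intro poly_eqI) (simp add: coeff_map_poly)

lemma map_poly_of_int_mult:
  "map_poly of_int (f * g) = (map_poly of_int f * map_poly of_int g :: 'a::comm_ring_1 poly)"
  by (intro poly_eqI) (simp add: coeff_map_poly coeff_mult)

lemma map_poly_of_int_smult:
  "map_poly of_int (Polynomial.smult c f)
     = (Polynomial.smult (of_int c) (map_poly of_int f) :: 'a::comm_ring_1 poly)"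
  by (intro poly_eqI) (simp add: coeff_map_poly)

text \<open>
  Eisenstein's criterion in the form that bounds the degree of an algebraic number from below. An
  integer polynomial of least degree vanishing at \<open>x\<close>, made primitive, divides \<open>\<phi>\<close> over the rationals,
  hence over the integers by Gauss's lemma; by \<open>eisenstein_degree\<close> the cofactor is constant.
\<close>

lemma eisenstein_root_degree:
  fixes \<phi> f :: "int poly" and x :: "'a::field_char_0" and q :: int
  assumes q: "Factorial_Ring.prime q"
    and monic: "Polynomial.lead_coeff \<phi> = 1"
    and lower: "\<And>i. i < Polynomial.degree \<phi> \<Longrightarrow> q dvd poly.coeff \<phi> i"
    and const: "\<not> q ^ 2 dvd poly.coeff \<phi> 0"
    and root: "poly (map_poly of_int \<phi>) x = 0"
    and f: "f \<noteq> 0" "poly (map_poly of_int f) x = 0"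
  shows "Polynomial.degree \<phi> \<le> Polynomial.degree f"
proof -
  define P where "P = (\<lambda>f :: int poly. f \<noteq> 0 \<and> poly (map_poly of_int f) x = 0)"
  define M where "M = arg_min Polynomial.degree P"
  have "P f" using f by (simp add: P_def)
  hence M: "P M" and Mmin: "\<And>h. P h \<Longrightarrow> Polynomial.degree M \<le> Polynomial.degree h"
    unfolding M_def by (auto intro: arg_min_natI arg_min_nat_le)
  define F where "F = primitive_part M"
  have F0: "F \<noteq> 0" using M by (simp add: F_def P_def)
  have cF: "content F = 1" using M by (simp add: F_def P_def)
  have "poly (map_poly of_int (Polynomial.smult (content M) F)) x = 0"
    using M by (simp add: F_def P_def)
  hence Fx: "poly (map_poly of_int F) x = 0"
    using M by (simp add: map_poly_of_int_smult P_def)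
  have Fmin: "Polynomial.degree F \<le> Polynomial.degree h" if "P h" for h
    using Mmin[OF that] by (simp add: F_def)
  (* Pseudo-division leaves a remainder that vanishes at x, so by minimality F divides c * \<phi>. The
     content is multiplicative and F is primitive, so c divides the quotient. *)
  obtain c Q where c: "c \<noteq> 0" and eq: "Polynomial.smult c \<phi> = F * Q + pseudo_mod \<phi> F"
    using pseudo_mod(1)[OF F0] by blast
  have "poly (map_poly of_int (pseudo_mod \<phi> F)) x = 0"
    using arg_cong[OF eq, of "\<lambda>h. poly (map_poly of_int h) x"] root Fx
    by (simp add: map_poly_of_int_smult map_poly_of_int_add map_poly_of_int_mult)
  hence "pseudo_mod \<phi> F = 0"
    using pseudo_mod(2)[OF F0, of \<phi>] Fmin[of "pseudo_mod \<phi> F"] by (fastforce simp: P_def)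
  hence eq: "Polynomial.smult c \<phi> = F * Q" using eq by simp
  have "content \<phi> = 1"
    using content_dvd_coeff[of \<phi> "Polynomial.degree \<phi>"] monic
    by (metis is_unit_content_iff)
  hence "content Q = \<bar>c\<bar>"
    using arg_cong[OF eq, of content] by (simp add: content_mult cF)
  hence "[:c:] dvd Q"
    by (metis abs_dvd_iff const_poly_dvd_iff_dvd_content dvd_refl)
  then obtain G where "Q = [:c:] * G" ..
  hence G: "Q = Polynomial.smult c G" by simp
  have phi: "\<phi> = F * G"
  proof (rule poly_eqI)
    fix i
    have "poly.coeff (Polynomial.smult c \<phi>) i = poly.coeff (Polynomial.smult c (F * G)) i"
      using eq by (simp add: G)
    thus "poly.coeff \<phi> i = poly.coeff (F * G) i" using c by simp
  qed
  have "Polynomial.degree F > 0"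
  proof (rule ccontr)
    assume "\<not> Polynomial.degree F > 0"
    then obtain a where "F = [:a:]" by (auto elim: degree_eq_zeroE)
    thus False using Fx F0 by (simp add: map_poly_pCons)
  qed
  hence "Polynomial.degree G = 0"
    using eisenstein_degree[OF q, of F G] monic lower const unfolding phi by blast
  hence "Polynomial.degree \<phi> = Polynomial.degree F"
    using phi F0 monic by (metis add.right_neutral degree_mult_eq leading_coeff_0_iff mult_zero_right zero_neq_one)
  also have "\<dots> \<le> Polynomial.degree f" using Fmin f by (simp add: P_def)
  finally show ?thesis .
qed

section \<open>The degree of the cyclotomic field\<close>

lemma zeta_power: "zeta p ^ n = cis (2 * pi * real n / real p)"
  by (simp add: zeta_def cis_conv_exp exp_of_nat_mult[symmetric] mult_ac)

lemma zeta_power_self: "p > 0 \<Longrightarrow> zeta p ^ p = 1"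
  by (simp add: zeta_power)

lemma zeta_power_eq_1_iff:
  assumes "p > 0" shows "zeta p ^ n = 1 \<longleftrightarrow> p dvd n"
proof
  assume "zeta p ^ n = 1"
  hence "cos (2 * pi * real n / real p) = 1"
    by (metis cis.sel(1) one_complex.sel(1) zeta_power)
  then obtain k :: int where "2 * pi * real n / real p = of_int k * 2 * pi"
    by (auto simp: cos_one_2pi_int)
  hence "real n = of_int k * real p" using assms by (simp add: field_simps)
  hence "int n = k * int p" by (metis of_int_eq_iff of_int_mult of_int_of_nat_eq)
  thus "p dvd n" by (metis dvd_triv_right int_dvd_int_iff)
next
  assume "p dvd n"
  then obtain k where "n = p * k" ..
  thus "zeta p ^ n = 1" using assms by (simp add: power_mult zeta_power_self)
qed

text \<open>
  This is \<open>\<Phi>\<^sub>p(X + 1) = ((X + 1)\<^sup>p - 1) / X\<close>, the form of the cyclotomic polynomial to which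
  Eisenstein's criterion applies.
\<close>

definition shifted_cyclotomic :: "nat \<Rightarrow> int poly" where
  "shifted_cyclotomic p = (\<Sum>i<p. Polynomial.monom (int (p choose Suc i)) i)"

lemma coeff_shifted_cyclotomic:
  "poly.coeff (shifted_cyclotomic p) i = (if i < p then int (p choose Suc i) else 0)"
  by (simp add: shifted_cyclotomic_def coeff_sum if_distrib cong: if_cong)

lemma degree_shifted_cyclotomic:
  assumes "p > 0" shows "Polynomial.degree (shifted_cyclotomic p) = p - 1"
proof (rule antisym)
  show "Polynomial.degree (shifted_cyclotomic p) \<le> p - 1"
    using assms by (intro degree_le) (auto simp: coeff_shifted_cyclotomic)
  show "p - 1 \<le> Polynomial.degree (shifted_cyclotomic p)"
    using assms by (intro le_degree) (auto simp: coeff_shifted_cyclotomic)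
qed

lemma shifted_cyclotomic_root:
  assumes "p > 1"
  shows "poly (map_poly of_int (shifted_cyclotomic p)) (zeta p - 1) = 0"
proof -
  have 1: "poly (map_poly of_int (shifted_cyclotomic p)) y = (\<Sum>i<p. of_nat (p choose Suc i) * y ^ i)"
    for y :: complex
  proof -
    have "poly (map_poly of_int (shifted_cyclotomic p)) y
        = (\<Sum>i\<le>p - 1. of_int (poly.coeff (shifted_cyclotomic p) i) * y ^ i)"
      using assms by (simp add: poly_altdef coeff_map_poly degree_map_poly degree_shifted_cyclotomic)
    also have "{..p - 1} = {..<p}" using assms by auto
    also have "(\<Sum>i<p. of_int (poly.coeff (shifted_cyclotomic p) i) * y ^ i) = (\<Sum>i<p. of_nat (p choose Suc i) * y ^ i)"
      by (intro sum.cong) (auto simp: coeff_shifted_cyclotomic)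
    finally show ?thesis .
  qed
  have "(y + 1) ^ p = 1 + y * poly (map_poly of_int (shifted_cyclotomic p)) y" for y :: complex
  proof -
    have "(y + 1) ^ p = (\<Sum>k\<le>p. of_nat (p choose k) * y ^ k)"
      by (simp add: binomial_ring)
    also have "\<dots> = 1 + (\<Sum>k<p. of_nat (p choose Suc k) * y ^ Suc k)"
      by (subst sum.atMost_shift) simp
    finally show ?thesis by (simp add: 1 sum_distrib_left mult_ac)
  qed
  from this[of "zeta p - 1"] have
    "(zeta p - 1) * poly (map_poly of_int (shifted_cyclotomic p)) (zeta p - 1) = 0"
    using assms by (simp add: zeta_power_self)
  moreover have "zeta p \<noteq> 1" using zeta_power_eq_1_iff[of p 1] assms by simp
  ultimately show ?thesis by simp
qed

text \<open>
  The shifted cyclotomic polynomial is an Eisenstein polynomial at \<open>p\<close>, with root \<open>zeta p - 1\<close>.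
\<close>

lemma int_poly_zeta_degree:
  fixes f :: "int poly"
  assumes p: "Factorial_Ring.prime p"
    and f: "f \<noteq> 0" "poly (map_poly of_int f) (zeta p) = 0"
  shows "p - 1 \<le> Polynomial.degree f"
proof -
  have p1: "p > 1" using p prime_gt_1_nat by blast
  define g where "g = pcompose f [:1, 1:]"
  have "map_poly of_int g = pcompose (map_poly of_int f) [:1, 1 :: complex:]"
    unfolding g_def
    by (induction f) (simp_all add: map_poly_pCons pcompose_pCons map_poly_of_int_add map_poly_of_int_mult)
  hence g: "poly (map_poly of_int g) (zeta p - 1) = 0"
    using f by (simp add: poly_pcompose)
  have degg: "Polynomial.degree g = Polynomial.degree f" by (simp add: g_def degree_pcompose)
  have "g \<noteq> 0" using f(1) by (simp add: g_def pcompose_eq_0_iff)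
  have "Polynomial.degree (shifted_cyclotomic p) \<le> Polynomial.degree g"
  proof (rule eisenstein_root_degree)
    show "Factorial_Ring.prime (int p)" using p by simp
    show "Polynomial.lead_coeff (shifted_cyclotomic p) = 1"
      using p1 by (simp add: degree_shifted_cyclotomic coeff_shifted_cyclotomic)
    show "int p dvd poly.coeff (shifted_cyclotomic p) i"
      if "i < Polynomial.degree (shifted_cyclotomic p)" for i
      using that p1 p by (auto simp: degree_shifted_cyclotomic coeff_shifted_cyclotomic
          intro!: dvd_choose_prime)
    show "\<not> (int p)\<^sup>2 dvd poly.coeff (shifted_cyclotomic p) 0"
      using p1 by (auto simp: coeff_shifted_cyclotomic power2_eq_square)
    show "poly (map_poly of_int (shifted_cyclotomic p)) (zeta p - 1) = 0"
      by (rule shifted_cyclotomic_root[OF p1])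
  qed (fact \<open>g \<noteq> 0\<close> g)+
  thus ?thesis using p1 degg by (simp add: degree_shifted_cyclotomic)
qed

definition rat_coeffs :: "complex poly \<Rightarrow> bool" where
  "rat_coeffs f \<longleftrightarrow> (\<forall>i. poly.coeff f i \<in> \<rat>)"

lemma rat_coeffs_0 [simp]: "rat_coeffs 0"
  by (simp add: rat_coeffs_def)

lemma rat_coeffs_add: "rat_coeffs f \<Longrightarrow> rat_coeffs h \<Longrightarrow> rat_coeffs (f + h)"
  by (simp add: rat_coeffs_def)

lemma rat_coeffs_mult: "rat_coeffs f \<Longrightarrow> rat_coeffs h \<Longrightarrow> rat_coeffs (f * h)"
  unfolding rat_coeffs_def coeff_mult by (auto intro!: Rats_sum Rats_mult)

lemma rat_coeffs_monom: "c \<in> \<rat> \<Longrightarrow> rat_coeffs (Polynomial.monom c n)"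
  by (simp add: rat_coeffs_def)

lemma rat_coeffs_pCons: "rat_coeffs (pCons a f) \<longleftrightarrow> a \<in> \<rat> \<and> rat_coeffs f"
  by (auto simp: rat_coeffs_def coeff_pCons split: nat.splits)

lemma rat_coeffs_pcompose: "rat_coeffs f \<Longrightarrow> rat_coeffs h \<Longrightarrow> rat_coeffs (pcompose f h)"
proof (induction f)
  case (pCons a f)
  thus ?case by (simp add: pcompose_pCons rat_coeffs_pCons rat_coeffs_add rat_coeffs_mult)
qed simp

lemma common_denominator:
  fixes c :: "nat \<Rightarrow> 'a::field_char_0"
  assumes "\<And>i. c i \<in> \<rat>"
  shows "\<exists>N::int. N \<noteq> 0 \<and> (\<forall>i<n. of_int N * c i \<in> \<int>)"
proof (induction n)
  case (Suc n)
  then obtain N :: int where N: "N \<noteq> 0" "\<forall>i<n. of_int N * c i \<in> \<int>" by blast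
  obtain a b :: int where ab: "b > 0" "c n = of_int a / of_int b"
    using Rats_cases'[OF assms] by metis
  have "of_int (N * b) * c i \<in> \<int>" if "i < Suc n" for i
  proof (cases "i = n")
    case True
    hence "of_int (N * b) * c i = of_int (N * a)" using ab by simp
    thus ?thesis by (simp only: Ints_of_int)
  next
    case False
    hence "of_int N * c i \<in> \<int>" using that N by auto
    hence "of_int b * (of_int N * c i) \<in> \<int>" by (rule Ints_mult[OF Ints_of_int])
    thus ?thesis by (simp add: mult_ac)
  qed
  thus ?case using N ab by (intro exI[of _ "N * b"]) auto
qed (auto intro: exI[of _ 1])

lemma rat_poly_zeta_degree:
  assumes p: "Factorial_Ring.prime p"
    and f: "rat_coeffs f" "f \<noteq> 0" "poly f (zeta p) = 0"
  shows "p - 1 \<le> Polynomial.degree f"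
proof -
  obtain N :: int where N: "N \<noteq> 0" "\<And>i. i < Suc (Polynomial.degree f) \<Longrightarrow> of_int N * poly.coeff f i \<in> \<int>"
    using common_denominator[of "poly.coeff f"] f(1) by (metis rat_coeffs_def)
  have "poly.coeff (Polynomial.smult (of_int N) f) i \<in> \<int>" for i
    using N(2)[of i] by (cases "i \<le> Polynomial.degree f") (auto simp: coeff_eq_0)
  then obtain h where h: "Polynomial.smult (of_int N) f = map_poly of_int h"
    by (rule intpolyE)
  have "Polynomial.degree h = Polynomial.degree f"
    using arg_cong[OF h, of Polynomial.degree] N by (simp add: degree_map_poly)
  moreover have "h \<noteq> 0" using h f N by auto
  moreover have "poly (map_poly of_int h) (zeta p) = 0"
    using f by (simp flip: h)
  ultimately show ?thesis using int_poly_zeta_degree[OF p, of h] by simp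
qed

text \<open>
  The only rational linear relations between \<open>1, \<zeta>, \<dots>, \<zeta>\<^bsup>p-1\<^esup>\<close> are the multiples of
  \<open>1 + \<zeta> + \<dots> + \<zeta>\<^bsup>p-1\<^esup> = 0\<close>: subtracting the multiple that kills the top coefficient leaves a relation
  whose degree is too small.
\<close>

lemma zeta_relation_constant:
  assumes p: "Factorial_Ring.prime p"
    and c: "\<And>k. c k \<in> \<rat>"
    and sum0: "(\<Sum>k<p. c k * zeta p ^ k) = 0"
    and k: "k < p"
  shows "c k = c (p - 1)"
proof (cases "k = p - 1")
  case False
  have p1: "p > 1" using p prime_gt_1_nat by blast
  define f where "f = (\<Sum>k<p-1. Polynomial.monom (c k - c (p - 1)) k)"
  have coeff: "poly.coeff f i = (if i < p - 1 then c i - c (p - 1) else 0)" for i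
    by (simp add: f_def coeff_sum if_distrib cong: if_cong)
  have geom: "(\<Sum>k<p. zeta p ^ k) = 0"
    using geometric_sum[of "zeta p" p] zeta_power_eq_1_iff[of p 1] p1
    by (simp add: zeta_power_self)
  have "poly f (zeta p) = (\<Sum>k<p-1. (c k - c (p - 1)) * zeta p ^ k)"
    by (simp add: f_def poly_sum poly_monom)
  also have "\<dots> = (\<Sum>k<p. (c k - c (p - 1)) * zeta p ^ k)"
    using p1 by (intro sum.mono_neutral_left) (auto simp: not_less dest!: le_antisym[of "p - Suc 0"])
  also have "\<dots> = (\<Sum>k<p. c k * zeta p ^ k) - c (p - 1) * (\<Sum>k<p. zeta p ^ k)"
    by (simp add: left_diff_distrib sum_subtractf sum_distrib_left)
  finally have root: "poly f (zeta p) = 0" using sum0 geom by simp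
  have "Polynomial.degree f < p - 1"
    using p1 False k by (intro degree_lessI) (auto simp: coeff)
  moreover have "rat_coeffs f" using c by (simp add: rat_coeffs_def coeff)
  ultimately have "f = 0" using rat_poly_zeta_degree[OF p _ _ root] by fastforce
  moreover have "k < p - 1" using False k by linarith
  ultimately show ?thesis using coeff[of k] by simp
qed auto

text \<open>
  Collecting exponents modulo \<open>p\<close> is division by \<open>X\<^sup>p - 1\<close> with explicit remainder. The remainder is the
  same for all \<open>p\<close>-th roots of unity \<open>z\<close>, which is what makes conjugation well defined below.
\<close>

lemma poly_root_of_unity_reduce:
  fixes z :: "'a::comm_ring_1"
  assumes "p > 0" "z ^ p = 1"
  shows "poly f z = (\<Sum>k<p. (\<Sum>n | n \<le> Polynomial.degree f \<and> n mod p = k. poly.coeff f n) * z ^ k)"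
proof -
  have red: "z ^ n = z ^ (n mod p)" for n
  proof -
    have "z ^ n = z ^ (p * (n div p) + n mod p)" by simp
    also have "\<dots> = z ^ (n mod p)" unfolding power_add power_mult assms(2) by simp
    finally show ?thesis .
  qed
  have "poly f z = (\<Sum>n\<le>Polynomial.degree f. poly.coeff f n * z ^ (n mod p))"
    unfolding poly_altdef by (intro sum.cong refl) (metis red)
  also have "\<dots> = (\<Sum>k<p. \<Sum>n | n \<in> {..Polynomial.degree f} \<and> n mod p = k. poly.coeff f n * z ^ (n mod p))"
    using assms by (subst sum.group) auto
  also have "\<dots> = (\<Sum>k<p. (\<Sum>n | n \<le> Polynomial.degree f \<and> n mod p = k. poly.coeff f n) * z ^ k)"
    by (intro sum.cong) (auto simp: sum_distrib_right intro!: sum.cong)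
  finally show ?thesis .
qed

text \<open>
  All primitive \<open>p\<close>-th roots of unity satisfy the same rational equations: reduced modulo \<open>X\<^sup>p - 1\<close>, a
  polynomial vanishing at \<open>\<zeta>\<close> is a multiple of \<open>1 + X + \<dots> + X\<^bsup>p-1\<^esup>\<close>.
\<close>

lemma rat_poly_zeta_conjugate:
  assumes p: "Factorial_Ring.prime p" and f: "rat_coeffs f" "poly f (zeta p) = 0"
    and t: "\<not> p dvd t"
  shows "poly f (zeta p ^ t) = 0"
proof -
  have p0: "p > 0" using p prime_gt_0_nat by blast
  define C where "C = (\<lambda>k. \<Sum>n | n \<le> Polynomial.degree f \<and> n mod p = k. poly.coeff f n)"
  have C: "C k \<in> \<rat>" for k unfolding C_def using f(1) by (intro Rats_sum) (auto simp: rat_coeffs_def)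
  have "(\<Sum>k<p. C k * zeta p ^ k) = 0"
    using f(2) poly_root_of_unity_reduce[of p "zeta p" f] p0 by (simp add: zeta_power_self C_def)
  hence const: "C k = C (p - 1)" if "k < p" for k
    using zeta_relation_constant[OF p] C that by blast
  have one: "(zeta p ^ t) ^ p = 1"
    by (metis mult.commute p0 power_mult power_one zeta_power_self)
  hence "poly f (zeta p ^ t) = (\<Sum>k<p. C k * (zeta p ^ t) ^ k)"
    using poly_root_of_unity_reduce[of p "zeta p ^ t" f] p0 by (simp add: C_def)
  also have "\<dots> = C (p - 1) * (\<Sum>k<p. (zeta p ^ t) ^ k)"
    unfolding sum_distrib_left by (intro sum.cong refl arg_cong2[where f = "(*)"] const) auto
  also have "(\<Sum>k<p. (zeta p ^ t) ^ k) = 0"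
    using geometric_sum[of "zeta p ^ t" p] one zeta_power_eq_1_iff[OF p0, of t] t by auto
  finally show ?thesis by simp
qed

section \<open>The Galois action on the cyclotomic field\<close>

lemma zeta_power_cong:
  assumes "p > 0" "[a = b] (mod p)" shows "zeta p ^ a = zeta p ^ b"
proof -
  have "zeta p ^ n = zeta p ^ (n mod p)" for n
  proof -
    have "zeta p ^ n = zeta p ^ (p * (n div p) + n mod p)" by simp
    also have "\<dots> = zeta p ^ (n mod p)"
      unfolding power_add power_mult zeta_power_self[OF assms(1)] by simp
    finally show ?thesis .
  qed
  from this[of a] this[of b] show ?thesis using assms(2) by (simp add: cong_def)
qed

text \<open>
  Splitting a sum or product over \<open>{..<d * e}\<close> by residues modulo \<open>d\<close>. Along the powers of a primitive
  root this is the decomposition of the multiplicative group into cosets.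
\<close>

lemma (in comm_monoid_set) lessThan_mult:
  fixes d e :: nat
  assumes "d > 0"
  shows "F h {..<d*e} = F (\<lambda>i. F (\<lambda>j. h (i + d * j)) {..<e}) {..<d}"
proof -
  have "F (\<lambda>i. F (\<lambda>j. h (i + d * j)) {..<e}) {..<d}
      = F (\<lambda>(i,j). h (i + d * j)) ({..<d} \<times> {..<e})"
    by (simp add: cartesian_product)
  also have "\<dots> = F h {..<d*e}"
  proof (rule reindex_bij_witness[of _ "\<lambda>n. (n mod d, n div d)" "\<lambda>(i,j). i + d * j"])
    fix a assume "a \<in> {..<d} \<times> {..<e}"
    then obtain i j where a: "a = (i, j)" "i < d" "j < e" by auto
    have "i + d * j < d * Suc j" using a by simp
    also have "\<dots> \<le> d * e" using a by (intro mult_le_mono) auto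
    finally show "(case a of (i, j) \<Rightarrow> i + d * j) \<in> {..<d * e}" using a by simp
  qed (use assms in \<open>auto simp: less_mult_imp_div_less mult.commute\<close>)
  finally show ?thesis ..
qed

locale cyclotomic_generator =
  fixes p g :: nat
  assumes prime_p: "Factorial_Ring.prime p" and primroot_g: "residue_primroot p g"
begin

lemma p_gt_1: "p > 1" using prime_p prime_gt_1_nat by blast

lemma p_gt_0: "p > 0" using p_gt_1 by simp

lemma generator_bij: "bij_betw (\<lambda>i. g ^ i mod p) {..<p-1} {1..<p}"
proof -
  have "totatives p = {1..<p}"
    unfolding totatives_prime[OF prime_p] by (simp add: set_eq_iff Suc_le_eq)
  moreover have "totient p = p - 1" using totient_prime[OF prime_p] .
  ultimately show ?thesis using residue_primroot_is_generator[OF p_gt_1 primroot_g] by simp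
qed

lemma not_dvd_generator_power: "\<not> p dvd g ^ n"
proof -
  have "coprime p g" using primroot_g by (simp add: residue_primroot_def)
  thus ?thesis using p_gt_1
    using coprime_common_divisor[of p "g ^ n" p] by auto
qed

lemma generator_power_period: "[g ^ (n + (p - 1) * k) = g ^ n] (mod p)"
proof -
  have "coprime g p" using primroot_g by (simp add: residue_primroot_def coprime_commute)
  hence "[g ^ (p - 1) = 1] (mod p)" using euler_theorem[of g p] totient_prime[OF prime_p] by simp
  hence "[g ^ n * (g ^ (p - 1)) ^ k = g ^ n * 1 ^ k] (mod p)"
    by (intro cong_mult cong_pow) auto
  thus ?thesis by (simp add: power_add power_mult)
qed

lemma zeta_generator_period: "zeta p ^ (g ^ (n + (p - 1) * k)) = zeta p ^ (g ^ n)"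
  by (rule zeta_power_cong[OF p_gt_0 generator_power_period])

lemma sum_zeta_generator:
  "(\<Sum>n<p-1. c n * zeta p ^ (g ^ n)) =
   (\<Sum>k\<in>{1..<p}. c (inv_into {..<p-1} (\<lambda>i. g ^ i mod p) k) * zeta p ^ k)"
proof -
  let ?G = "\<lambda>i. g ^ i mod p"
  have "(\<Sum>k\<in>{1..<p}. c (inv_into {..<p-1} ?G k) * zeta p ^ k)
     = (\<Sum>n<p-1. c (inv_into {..<p-1} ?G (?G n)) * zeta p ^ (?G n))"
    by (rule sum.reindex_bij_betw[OF generator_bij, symmetric])
  also have "\<dots> = (\<Sum>n<p-1. c n * zeta p ^ (g ^ n))"
  proof (intro sum.cong refl arg_cong2[where f = "(*)"] arg_cong[where f = c])
    fix n assume "n \<in> {..<p-1}"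
    thus "inv_into {..<p-1} ?G (?G n) = n"
      using generator_bij by (intro inv_into_f_f) (auto simp: bij_betw_def)
  next
    fix n show "zeta p ^ (?G n) = zeta p ^ (g ^ n)"
      by (rule zeta_power_cong[OF p_gt_0]) auto
  qed
  finally show ?thesis ..
qed

text \<open>
  The conjugates \<open>\<zeta>\<^bsup>g\<^sup>n\<^esup>\<close> are \<open>\<zeta>, \<dots>, \<zeta>\<^bsup>p-1\<^esup>\<close> in another order, and a relation without constant term is
  zero because its coefficients are all equal.
\<close>

lemma zeta_generator_independent:
  assumes c: "\<And>n. c n \<in> \<rat>" and sum0: "(\<Sum>n<p-1. c n * zeta p ^ (g ^ n)) = 0"
    and n: "n < p - 1"
  shows "c n = 0"
proof -
  define G where "G = (\<lambda>i. g ^ i mod p)"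
  define C where "C = (\<lambda>k. if k = 0 then 0 else c (inv_into {..<p-1} G k))"
  have "(\<Sum>k<p. C k * zeta p ^ k) = (\<Sum>k\<in>{1..<p}. C k * zeta p ^ k)"
    using p_gt_0 by (intro sum.mono_neutral_right) (auto simp: C_def)
  also have "\<dots> = (\<Sum>k\<in>{1..<p}. c (inv_into {..<p-1} G k) * zeta p ^ k)"
    by (intro sum.cong) (auto simp: C_def)
  also have "\<dots> = 0" using sum0 sum_zeta_generator[of c] by (simp add: G_def)
  finally have sumC: "(\<Sum>k<p. C k * zeta p ^ k) = 0" .
  have C_rat: "C k \<in> \<rat>" for k by (simp add: C_def c)
  have Gn: "G n \<in> {1..<p}" using bij_betwE[OF generator_bij] n by (simp add: G_def)
  have "C (G n) = C (p - 1)"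
    using zeta_relation_constant[OF prime_p C_rat sumC, of "G n"] Gn by simp
  also have "\<dots> = C 0"
    using zeta_relation_constant[OF prime_p C_rat sumC, of 0] p_gt_0 by simp
  also have "\<dots> = 0" by (simp add: C_def)
  finally have "C (G n) = 0" .
  moreover have "inv_into {..<p-1} G (G n) = n"
    using generator_bij n by (intro inv_into_f_f) (auto simp: bij_betw_def G_def)
  ultimately show ?thesis using Gn by (simp add: C_def)
qed

definition Q_zeta :: "complex set" where
  "Q_zeta = {poly f (zeta p) | f. rat_coeffs f}"

text \<open>
  The automorphism of the cyclotomic field with \<open>\<zeta> \<mapsto> \<zeta>\<^sup>g\<close>, a generator of the Galois group. The value
  does not depend on the chosen polynomial, by \<open>rat_poly_zeta_conjugate\<close>.
\<close>

definition galois :: "complex \<Rightarrow> complex" where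
  "galois x = poly (SOME f. rat_coeffs f \<and> poly f (zeta p) = x) (zeta p ^ g)"

lemma poly_in_Q_zeta: "rat_coeffs f \<Longrightarrow> poly f (zeta p) \<in> Q_zeta"
  by (auto simp: Q_zeta_def)

lemma Q_zeta_cases:
  assumes "x \<in> Q_zeta" obtains f where "rat_coeffs f" "x = poly f (zeta p)"
  using assms by (auto simp: Q_zeta_def)

lemma galois_poly:
  assumes "rat_coeffs f" shows "galois (poly f (zeta p)) = poly f (zeta p ^ g)"
proof -
  define h where "h = (SOME h. rat_coeffs h \<and> poly h (zeta p) = poly f (zeta p))"
  have h: "rat_coeffs h \<and> poly h (zeta p) = poly f (zeta p)"
    unfolding h_def by (rule someI[of _ f]) (use assms in simp)
  have "rat_coeffs (h - f)" using h assms by (simp add: rat_coeffs_def)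
  moreover have "poly (h - f) (zeta p) = 0" using h by simp
  moreover have "\<not> p dvd g" using not_dvd_generator_power[of 1] by simp
  ultimately have "poly (h - f) (zeta p ^ g) = 0" by (rule rat_poly_zeta_conjugate[OF prime_p])
  thus ?thesis by (simp add: galois_def h_def)
qed

lemma poly_zeta_power_in_Q_zeta: "rat_coeffs f \<Longrightarrow> poly f (zeta p ^ n) \<in> Q_zeta"
  using poly_in_Q_zeta[of "pcompose f (Polynomial.monom 1 n)"]
  by (simp add: poly_pcompose poly_monom rat_coeffs_pcompose rat_coeffs_monom)

lemma galois_closed: "x \<in> Q_zeta \<Longrightarrow> galois x \<in> Q_zeta"
  by (auto simp: galois_poly poly_zeta_power_in_Q_zeta elim!: Q_zeta_cases)

lemma Q_zeta_rat: "c \<in> \<rat> \<Longrightarrow> c \<in> Q_zeta"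
  using poly_in_Q_zeta[of "[:c:]"] by (simp add: rat_coeffs_pCons)

lemma galois_rat: "c \<in> \<rat> \<Longrightarrow> galois c = c"
  using galois_poly[of "[:c:]"] by (simp add: rat_coeffs_pCons)

lemma Q_zeta_zeta_power: "zeta p ^ n \<in> Q_zeta"
  using poly_zeta_power_in_Q_zeta[of "Polynomial.monom 1 1"] by (simp add: poly_monom rat_coeffs_monom)

lemma galois_zeta_power: "galois (zeta p ^ n) = zeta p ^ (n * g)"
  using galois_poly[of "Polynomial.monom 1 n"]
  by (simp add: poly_monom rat_coeffs_monom power_mult mult.commute)

lemma Q_zeta_add: "x \<in> Q_zeta \<Longrightarrow> y \<in> Q_zeta \<Longrightarrow> x + y \<in> Q_zeta"
  by (elim Q_zeta_cases) (simp add: poly_in_Q_zeta rat_coeffs_add flip: poly_add)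

lemma galois_add: "x \<in> Q_zeta \<Longrightarrow> y \<in> Q_zeta \<Longrightarrow> galois (x + y) = galois x + galois y"
proof (elim Q_zeta_cases)
  fix f h assume "rat_coeffs f" "x = poly f (zeta p)" "rat_coeffs h" "y = poly h (zeta p)"
  thus ?thesis using galois_poly[of f] galois_poly[of h] galois_poly[of "f + h"] by (simp add: rat_coeffs_add)
qed

lemma Q_zeta_mult: "x \<in> Q_zeta \<Longrightarrow> y \<in> Q_zeta \<Longrightarrow> x * y \<in> Q_zeta"
  by (elim Q_zeta_cases) (simp add: poly_in_Q_zeta rat_coeffs_mult flip: poly_mult)

lemma galois_mult: "x \<in> Q_zeta \<Longrightarrow> y \<in> Q_zeta \<Longrightarrow> galois (x * y) = galois x * galois y"
proof (elim Q_zeta_cases)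
  fix f h assume "rat_coeffs f" "x = poly f (zeta p)" "rat_coeffs h" "y = poly h (zeta p)"
  thus ?thesis using galois_poly[of f] galois_poly[of h] galois_poly[of "f * h"] by (simp add: rat_coeffs_mult)
qed

lemma Q_zeta_uminus: "x \<in> Q_zeta \<Longrightarrow> - x \<in> Q_zeta"
  using Q_zeta_mult[OF Q_zeta_rat, of "-1" x] by simp

lemma Q_zeta_diff: "x \<in> Q_zeta \<Longrightarrow> y \<in> Q_zeta \<Longrightarrow> x - y \<in> Q_zeta"
  using Q_zeta_add[OF _ Q_zeta_uminus, of x y] by simp

lemma galois_diff: "x \<in> Q_zeta \<Longrightarrow> y \<in> Q_zeta \<Longrightarrow> galois (x - y) = galois x - galois y"
  using galois_add[OF Q_zeta_diff, of x y y] by simp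

lemma Q_zeta_sum: "(\<And>i. i \<in> A \<Longrightarrow> f i \<in> Q_zeta) \<Longrightarrow> sum f A \<in> Q_zeta"
  by (induction A rule: infinite_finite_induct) (auto simp: Q_zeta_rat Q_zeta_add)

lemma Q_zeta_prod: "(\<And>i. i \<in> A \<Longrightarrow> f i \<in> Q_zeta) \<Longrightarrow> prod f A \<in> Q_zeta"
  by (induction A rule: infinite_finite_induct) (auto simp: Q_zeta_rat Q_zeta_mult)

lemma galois_prod: "(\<And>i. i \<in> A \<Longrightarrow> f i \<in> Q_zeta) \<Longrightarrow> galois (prod f A) = (\<Prod>i\<in>A. galois (f i))"
  by (induction A rule: infinite_finite_induct) (auto simp: galois_rat galois_mult Q_zeta_prod)

lemma galois_funpow_closed: "x \<in> Q_zeta \<Longrightarrow> (galois ^^ n) x \<in> Q_zeta"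
  by (induction n) (auto simp: galois_closed)

lemma galois_funpow_rat: "c \<in> \<rat> \<Longrightarrow> (galois ^^ n) c = c"
  by (induction n) (auto simp: galois_rat)

lemma galois_funpow_add: "x \<in> Q_zeta \<Longrightarrow> y \<in> Q_zeta \<Longrightarrow> (galois ^^ n) (x + y) = (galois ^^ n) x + (galois ^^ n) y"
  by (induction n) (auto simp: galois_add galois_funpow_closed)

lemma galois_funpow_mult: "x \<in> Q_zeta \<Longrightarrow> y \<in> Q_zeta \<Longrightarrow> (galois ^^ n) (x * y) = (galois ^^ n) x * (galois ^^ n) y"
  by (induction n) (auto simp: galois_mult galois_funpow_closed)

lemma galois_funpow_sum: "(\<And>i. i \<in> A \<Longrightarrow> f i \<in> Q_zeta) \<Longrightarrow> (galois ^^ n) (sum f A) = (\<Sum>i\<in>A. (galois ^^ n) (f i))"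
  by (induction A rule: infinite_finite_induct) (auto simp: galois_funpow_rat galois_funpow_add Q_zeta_sum)

lemma galois_funpow_zeta_power: "(galois ^^ n) (zeta p ^ k) = zeta p ^ (k * g ^ n)"
  by (induction n) (auto simp: galois_zeta_power mult_ac)

lemma galois_funpow_zeta_generator: "(galois ^^ k) (zeta p ^ (g ^ n)) = zeta p ^ (g ^ (n + k))"
  by (simp add: galois_funpow_zeta_power power_add)

text \<open>
  The basis of conjugates, which the automorphism permutes cyclically. The constant term is removed by
  means of \<open>1 + \<zeta> + \<dots> + \<zeta>\<^bsup>p-1\<^esup> = 0\<close>.
\<close>

lemma Q_zeta_generator_basis:
  assumes "x \<in> Q_zeta"
  obtains c where "\<And>n. c n \<in> \<rat>" "x = (\<Sum>n<p-1. c n * zeta p ^ (g ^ n))"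
proof -
  obtain f where f: "rat_coeffs f" "x = poly f (zeta p)" using assms by (rule Q_zeta_cases)
  define C where "C = (\<lambda>k. \<Sum>n | n \<le> Polynomial.degree f \<and> n mod p = k. poly.coeff f n)"
  have C: "C k \<in> \<rat>" for k unfolding C_def using f(1) by (intro Rats_sum) (auto simp: rat_coeffs_def)
  define c where "c = (\<lambda>n. C (g ^ n mod p) - C 0)"
  have geom: "(\<Sum>k<p. zeta p ^ k) = 0"
    using geometric_sum[of "zeta p" p] zeta_power_eq_1_iff[of p 1] p_gt_1
    by (simp add: zeta_power_self)
  have "x = (\<Sum>k<p. C k * zeta p ^ k)"
    unfolding f(2) C_def by (rule poly_root_of_unity_reduce) (auto simp: p_gt_0 zeta_power_self)
  also have "\<dots> = (\<Sum>k<p. C k * zeta p ^ k) - C 0 * (\<Sum>k<p. zeta p ^ k)"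
    using geom by simp
  also have "\<dots> = (\<Sum>k<p. (C k - C 0) * zeta p ^ k)"
    by (simp add: sum_distrib_left sum_subtractf left_diff_distrib)
  also have "\<dots> = (\<Sum>k\<in>{1..<p}. (C k - C 0) * zeta p ^ k)"
    by (intro sum.mono_neutral_right) (auto simp: not_le)
  also have "\<dots> = (\<Sum>k\<in>{1..<p}. c (inv_into {..<p-1} (\<lambda>i. g ^ i mod p) k) * zeta p ^ k)"
    by (intro sum.cong) (simp_all add: c_def bij_betw_inv_into_right[OF generator_bij] del: One_nat_def)
  also have "\<dots> = (\<Sum>n<p-1. c n * zeta p ^ (g ^ n))"
    by (rule sum_zeta_generator[symmetric])
  finally have "x = (\<Sum>n<p-1. c n * zeta p ^ (g ^ n))" .
  moreover have "c n \<in> \<rat>" for n by (simp add: c_def C)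
  ultimately show ?thesis using that by blast
qed

lemma galois_order: 
  assumes "x \<in> Q_zeta" shows "(galois ^^ ((p - 1) * k)) x = x"
proof -
  obtain c where c: "\<And>n. c n \<in> \<rat>" "x = (\<Sum>n<p-1. c n * zeta p ^ (g ^ n))"
    using Q_zeta_generator_basis[OF assms] by blast
  have "(galois ^^ ((p - 1) * k)) x = (\<Sum>n<p-1. (galois ^^ ((p - 1) * k)) (c n * zeta p ^ (g ^ n)))"
    unfolding c(2) by (intro galois_funpow_sum Q_zeta_mult Q_zeta_rat c Q_zeta_zeta_power)
  also have "\<dots> = x"
    unfolding c(2) by (simp add: galois_funpow_mult Q_zeta_rat c(1) Q_zeta_zeta_power galois_funpow_rat
        galois_funpow_zeta_generator zeta_generator_period del: One_nat_def)
  finally show ?thesis .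
qed

text \<open>
  Some further power of the automorphism completes its \<open>n\<close>-th power to the identity.
\<close>

lemma galois_funpow_inj:
  assumes "x \<in> Q_zeta" "y \<in> Q_zeta" "(galois ^^ n) x = (galois ^^ n) y" shows "x = y"
proof -
  have "(p - 1) * n = ((p - 1) * n - n) + n" using p_gt_1 by (cases "p - 1") auto
  hence "(galois ^^ ((p - 1) * n)) z = (galois ^^ ((p - 1) * n - n)) ((galois ^^ n) z)" for z
    using fun_cong[OF funpow_add[of "(p - 1) * n - n" n galois], of z] by simp
  thus ?thesis using assms galois_order[of x n] galois_order[of y n] by simp
qed

section \<open>Gaussian periods and fixed fields\<close>

definition fixed_field :: "nat \<Rightarrow> complex set" where
  "fixed_field d = {x \<in> Q_zeta. (galois ^^ d) x = x}"

text \<open>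
  The Gaussian periods: traces of the conjugates of \<open>\<zeta>\<close> to the fixed field of \<open>galois ^^ d\<close>.
\<close>

definition period :: "nat \<Rightarrow> nat \<Rightarrow> complex" where
  "period d n = (\<Sum>j<(p - 1) div d. zeta p ^ (g ^ (n + d * j)))"

lemma period_in_Q_zeta: "period d n \<in> Q_zeta"
  unfolding period_def by (intro Q_zeta_sum Q_zeta_zeta_power)

lemma period_shift:
  assumes "d dvd p - 1" shows "period d (n + d) = period d n"
proof -
  define e where "e = (p - 1) div d"
  have e: "p - 1 = d * e" using assms by (simp add: e_def)
  define h where "h = (\<lambda>j. zeta p ^ (g ^ (n + d * j)))"
  have "h e = h 0" using zeta_generator_period[of n 1] unfolding h_def e by simp
  have "sum h {..<e} + h e = h 0 + (\<Sum>j<e. h (Suc j))"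
    using sum.lessThan_Suc[of h e] sum.lessThan_Suc_shift[of h e] by simp
  hence "(\<Sum>j<e. h (Suc j)) = sum h {..<e}" using \<open>h e = h 0\<close> by simp
  thus ?thesis by (simp add: period_def h_def e_def add_ac)
qed

lemma period_mod:
  assumes "d dvd p - 1" shows "period d n = period d (n mod d)"
proof -
  have "period d (k + d * j) = period d k" for k j
  proof (induction j)
    case (Suc j)
    have "k + d * Suc j = (k + d * j) + d" by simp
    thus ?case using Suc period_shift[OF assms, of "k + d * j"] by metis
  qed simp
  from this[of "n mod d" "n div d"] show ?thesis by simp
qed

lemma galois_funpow_period: "(galois ^^ k) (period d n) = period d (n + k)"
  unfolding period_def
  by (subst galois_funpow_sum) (auto simp: Q_zeta_zeta_power galois_funpow_zeta_generator add_ac)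

lemma period_in_fixed_field: "d dvd p - 1 \<Longrightarrow> period d n \<in> fixed_field d"
  by (simp add: fixed_field_def period_in_Q_zeta galois_funpow_period period_shift)

lemma fixed_field_funpow_mult: "x \<in> fixed_field d \<Longrightarrow> (galois ^^ (d * j)) x = x"
  by (induction j) (auto simp: fixed_field_def funpow_add)

text \<open>
  Summing a fixed element over its orbit under \<open>galois ^^ d\<close> multiplies it by \<open>e = (p - 1) / d\<close>, while each
  basis element \<open>\<zeta>\<^bsup>g\<^sup>n\<^esup>\<close> becomes a period.
\<close>

lemma fixed_field_span:
  assumes d: "d dvd p - 1" and x: "x \<in> fixed_field d"
  obtains a where "\<And>i. a i \<in> \<rat>" "x = (\<Sum>i<d. a i * period d i)"
proof -
  define e where "e = (p - 1) div d"
  have e: "p - 1 = d * e" using d by (simp add: e_def)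
  have e0: "e > 0" "d > 0" using e p_gt_1 by (auto intro!: Nat.gr0I)
  obtain c where c: "\<And>n. c n \<in> \<rat>" "x = (\<Sum>n<p-1. c n * zeta p ^ (g ^ n))"
    using Q_zeta_generator_basis x by (auto simp: fixed_field_def)
  have orbit: "(galois ^^ k) x = (\<Sum>n<p-1. c n * zeta p ^ (g ^ (n + k)))" for k
  proof -
    have "(galois ^^ k) x = (\<Sum>n<p-1. (galois ^^ k) (c n * zeta p ^ (g ^ n)))"
      unfolding c(2) by (intro galois_funpow_sum Q_zeta_mult Q_zeta_rat c Q_zeta_zeta_power)
    thus ?thesis by (simp add: galois_funpow_mult Q_zeta_rat c(1) Q_zeta_zeta_power galois_funpow_rat galois_funpow_zeta_generator)
  qed
  have "of_nat e * x = (\<Sum>j<e. (galois ^^ (d * j)) x)"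
    using fixed_field_funpow_mult[OF x] by simp
  also have "\<dots> = (\<Sum>n<p-1. c n * period d n)"
    unfolding orbit by (subst sum.swap) (simp add: period_def e_def sum_distrib_left)
  also have "\<dots> = (\<Sum>n<p-1. c n * period d (n mod d))"
    by (simp flip: period_mod[OF d])
  also have "\<dots> = (\<Sum>i<d. \<Sum>n | n \<in> {..<p-1} \<and> n mod d = i. c n * period d (n mod d))"
    using e0 by (subst sum.group) auto
  also have "\<dots> = (\<Sum>i<d. (\<Sum>n | n < p - 1 \<and> n mod d = i. c n) * period d i)"
    by (intro sum.cong) (auto simp: sum_distrib_right intro!: sum.cong)
  finally have ex: "of_nat e * x = (\<Sum>i<d. (\<Sum>n | n < p - 1 \<and> n mod d = i. c n) * period d i)" .
  define a where "a = (\<lambda>i. (\<Sum>n | n < p - 1 \<and> n mod d = i. c n) / of_nat e)"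
  have "a i \<in> \<rat>" for i unfolding a_def by (intro Rats_divide Rats_sum c) auto
  moreover have "(\<Sum>i<d. a i * period d i) = of_nat e * x / of_nat e"
    unfolding ex a_def by (subst sum_divide_distrib) simp
  hence "x = (\<Sum>i<d. a i * period d i)" using e0 by simp
  ultimately show ?thesis by (rule that)
qed

text \<open>
  Distinct periods are sums over disjoint parts of the basis of conjugates.
\<close>

lemma periods_independent:
  assumes d: "d dvd p - 1" and a: "\<And>i. a i \<in> \<rat>"
    and sum0: "(\<Sum>i<d. a i * period d i) = 0" and i: "i < d"
  shows "a i = 0"
proof -
  define e where "e = (p - 1) div d"
  have e: "p - 1 = d * e" using d by (simp add: e_def)
  have e0: "e > 0" "d > 0" using e p_gt_1 by (auto intro!: Nat.gr0I)
  have "(\<Sum>n<p-1. a (n mod d) * zeta p ^ (g ^ n)) = (\<Sum>i<d. a i * period d i)"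
    unfolding e sum.lessThan_mult[OF e0(2)] 
    by (intro sum.cong) (auto simp: period_def sum_distrib_left simp del: One_nat_def simp flip: e_def)
  moreover have "i < p - 1"
  proof -
    have "d * 1 \<le> d * e" using e0 by (intro mult_le_mono) auto
    thus ?thesis using i unfolding e by linarith
  qed
  ultimately have "a (i mod d) = 0"
    using zeta_generator_independent[of "\<lambda>n. a (n mod d)" i] a sum0 by simp
  thus ?thesis using i by simp
qed

lemma fixed_field_1: "fixed_field 1 = \<rat>"
proof
  have 1: "\<exists>a\<in>\<rat>. x = a * period 1 0" if "x \<in> fixed_field 1" for x
  proof -
    obtain a where "\<And>i. a i \<in> \<rat>" "x = (\<Sum>i<1. a i * period 1 i)"
      using fixed_field_span[of 1 x] \<open>x \<in> fixed_field 1\<close> by (metis one_dvd)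
    thus ?thesis by auto
  qed
  (* Elements of the fixed field are rational multiples of the single period, and 1 is one of them. *)
  have "1 \<in> fixed_field 1" by (simp add: fixed_field_def Q_zeta_rat galois_rat)
  then obtain b where b: "b \<in> \<rat>" "1 = b * period 1 0" using 1 by blast
  show "fixed_field 1 \<subseteq> \<rat>"
  proof
    fix x assume "x \<in> fixed_field 1"
    then obtain a where a: "a \<in> \<rat>" "x = a * period 1 0" using 1 by blast
    have "b \<noteq> 0" using b by auto
    hence "x = a / b" using a b by (simp add: field_simps)
    thus "x \<in> \<rat>" using a b by simp
  qed
qed (auto simp: fixed_field_def Q_zeta_rat galois_rat)

text \<open>
  The norm of \<open>x\<close> is fixed by the automorphism, hence rational, and it is \<open>x\<close> times the product of the
  other conjugates; so that product, divided by the norm, is the inverse.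
\<close>

lemma Q_zeta_inverse:
  assumes x: "x \<in> Q_zeta" shows "inverse x \<in> Q_zeta"
proof (cases "x = 0")
  case False
  obtain q where q: "p - 1 = Suc q" using p_gt_1 by (cases "p - 1") auto
  define N where "N = (\<Prod>n<Suc q. (galois ^^ n) x)"
  define y where "y = (\<Prod>n<q. (galois ^^ (Suc n)) x)"
  have Ny: "N = x * y" unfolding N_def y_def by (subst prod.lessThan_Suc_shift) simp
  have y: "y \<in> Q_zeta" unfolding y_def by (intro Q_zeta_prod galois_funpow_closed x)
  have "galois N = (\<Prod>n<Suc q. (galois ^^ (Suc n)) x)"
    unfolding N_def by (subst galois_prod) (auto intro: galois_closed galois_funpow_closed x)
  also have "\<dots> = y * (galois ^^ (Suc q)) x" by (simp add: y_def)
  also have "(galois ^^ (Suc q)) x = x" using galois_order[OF x, of 1] q by simp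
  finally have "galois N = N" by (simp add: Ny mult.commute)
  hence "N \<in> fixed_field 1" using Q_zeta_mult[OF x y] by (simp add: fixed_field_def Ny)
  hence N: "N \<in> \<rat>" using fixed_field_1 by blast
  have "(galois ^^ n) x \<noteq> 0" for n
    using galois_funpow_inj[OF x Q_zeta_rat[OF Rats_0], of n] False by (auto simp: galois_funpow_rat)
  hence "N \<noteq> 0" by (simp add: N_def)
  hence "inverse x = y * inverse N" using Ny False by (simp add: field_simps)
  thus ?thesis using y N by (simp add: Q_zeta_mult Q_zeta_rat)
qed (use x in simp)

end

section \<open>Subfields of the complex numbers\<close>

lemma complex_ring_simps [simp]:
  "carrier complex_ring = UNIV"
  "x \<otimes>\<^bsub>complex_ring\<^esub> y = x * y"
  "\<one>\<^bsub>complex_ring\<^esub> = 1"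
  "\<zero>\<^bsub>complex_ring\<^esub> = 0"
  "x \<oplus>\<^bsub>complex_ring\<^esub> y = x + y"
  by (simp_all add: complex_ring_def ring_of_type_algebra_def)

lemma field_complex_ring: "field complex_ring"
  unfolding complex_ring_def by (rule field_from_type_algebra)

interpretation CR: ring complex_ring
  unfolding complex_ring_def by (rule ring_from_type_algebra)

lemma complex_ring_a_inv [simp]: "\<ominus>\<^bsub>complex_ring\<^esub> x = - x"
  using CR.minus_equality[of "- x" x] by simp

lemma complex_ring_m_inv [simp]: "x \<noteq> 0 \<Longrightarrow> inv\<^bsub>complex_ring\<^esub> x = inverse x"
  using CR.inv_char[of x "inverse x"] by simp

lemma subfield_complexI:
  assumes "1 \<in> K" "\<And>x. x \<in> K \<Longrightarrow> - x \<in> K" "\<And>x y. x \<in> K \<Longrightarrow> y \<in> K \<Longrightarrow> x + y \<in> K"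
    "\<And>x y. x \<in> K \<Longrightarrow> y \<in> K \<Longrightarrow> x * y \<in> K" "\<And>x. x \<in> K \<Longrightarrow> x \<noteq> 0 \<Longrightarrow> inverse x \<in> K"
  shows "subfield K complex_ring"
  by (intro field.subfieldI'[OF field_complex_ring] CR.subringI) (use assms in auto)

lemma subfield_complexD:
  assumes "subfield K complex_ring"
  shows "1 \<in> K" "0 \<in> K" "\<And>x. x \<in> K \<Longrightarrow> - x \<in> K" "\<And>x y. x \<in> K \<Longrightarrow> y \<in> K \<Longrightarrow> x + y \<in> K"
    "\<And>x y. x \<in> K \<Longrightarrow> y \<in> K \<Longrightarrow> x * y \<in> K" "\<And>x. x \<in> K \<Longrightarrow> x \<noteq> 0 \<Longrightarrow> inverse x \<in> K"
proof -
  note S = subfieldE(1)[OF assms]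
  show "1 \<in> K" using subringE(3)[OF S] by simp
  show "0 \<in> K" using subringE(2)[OF S] by simp
  show "\<And>x. x \<in> K \<Longrightarrow> - x \<in> K" using subringE(5)[OF S] by simp
  show "\<And>x y. x \<in> K \<Longrightarrow> y \<in> K \<Longrightarrow> x * y \<in> K" using subringE(6)[OF S] by simp
  show "\<And>x y. x \<in> K \<Longrightarrow> y \<in> K \<Longrightarrow> x + y \<in> K" using subringE(7)[OF S] by simp
  show "\<And>x. x \<in> K \<Longrightarrow> x \<noteq> 0 \<Longrightarrow> inverse x \<in> K" 
    using CR.subfield_m_inv(1)[OF assms] by auto
qed

lemma Rats_subset_subfield:
  assumes K: "subfield K complex_ring" shows "\<rat> \<subseteq> K"
proof
  note D = subfield_complexD[OF K]
  have nat: "of_nat n \<in> K" for n by (induction n) (auto intro: D)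
  have int: "of_int n \<in> K" for n by (cases n) (auto intro: D nat simp del: of_nat_Suc)
  fix x :: complex assume "x \<in> \<rat>"
  then obtain a b :: int where "b > 0" "x = of_int a / of_int b"
    using Rats_cases' by metis
  thus "x \<in> K" using D(5)[OF int D(6)[OF int], of b a] by (simp add: divide_inverse)
qed

lemma subfield_Rats: "subfield \<rat> complex_ring"
  by (rule subfield_complexI) auto

lemma combine_complex_ring:
  "length Ks = length Us \<Longrightarrow> CR.combine Ks Us = (\<Sum>i<length Us. Ks ! i * Us ! i)"
proof (induction Ks Us rule: list_induct2)
  case (Cons k Ks u Us)
  show ?case unfolding list.size sum.lessThan_Suc_shift add_0_right add_Suc_right
    using Cons by simp
qed simp

lemma subfield_poly_closed:
  assumes K: "subfield K complex_ring" and f: "rat_coeffs f" and x: "x \<in> K"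
  shows "poly f x \<in> K"
  using f
proof (induction f)
  case 0
  thus ?case using subfield_complexD[OF K] by simp
next
  case (pCons a f)
  thus ?case using subfield_complexD(4,5)[OF K] Rats_subset_subfield[OF K] x
    by (auto simp: rat_coeffs_pCons)
qed

text \<open>
  The \<open>n + 1\<close> powers \<open>1, x, \<dots>, x\<^sup>n\<close> are linearly dependent.
\<close>

lemma algebraic_over_Rats_of_dimension:
  assumes K: "subfield K complex_ring" and dim: "CR.dimension n \<rat> K" and x: "x \<in> K"
  obtains f where "rat_coeffs f" "f \<noteq> 0" "Polynomial.degree f \<le> n" "poly f x = 0"
proof -
  define Us where "Us = map (\<lambda>i. x ^ i) [0..<Suc n]"
  have "x ^ i \<in> K" for i by (induction i) (auto intro: subfield_complexD[OF K] x)
  hence UsK: "set Us \<subseteq> K" by (auto simp: Us_def)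
  have "\<not> CR.independent \<rat> Us"
    using CR.independent_length_le_dimension[OF subfield_Rats dim _ UsK] by (auto simp: Us_def)
  then obtain Ks where Ks: "length Ks = length Us" "CR.combine Ks Us = 0" "set Ks \<subseteq> \<rat>" "set Ks \<noteq> {0}"
    using CR.dependent_imp_non_trivial_combine[OF subfield_Rats, of Us] by auto
  define f where "f = Poly Ks"
  have "poly.coeff f i \<in> \<rat>" for i
    using Ks(3) by (auto simp: f_def nth_default_def)
  moreover have "f \<noteq> 0"
  proof
    assume "f = 0"
    then obtain k where k: "Ks = replicate k 0" by (auto simp: f_def Poly_eq_0)
    moreover have "k \<noteq> 0" using Ks(1) k by (auto simp: Us_def)
    ultimately show False using Ks(4) by (simp add: set_replicate)
  qed
  moreover have "Polynomial.degree f \<le> n"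
    using Ks(1) by (intro degree_le) (auto simp: f_def nth_default_def Us_def)
  moreover have "poly f x = 0"
  proof -
    have "poly (Poly Ks) x = (\<Sum>i<length Ks. Ks ! i * x ^ i)"
    proof (induction Ks)
      case (Cons a Ks)
      show ?case unfolding list.size sum.lessThan_Suc_shift add_0_right add_Suc_right
        using Cons by (simp add: sum_distrib_left mult_ac)
    qed simp
    also have "\<dots> = (\<Sum>i<length Us. Ks ! i * Us ! i)"
      by (intro sum.cong) (auto simp: Ks(1) Us_def simp del: upt_Suc)
    also have "\<dots> = 0" using combine_complex_ring[OF Ks(1)] Ks(2) by simp
    finally show ?thesis by (simp add: f_def)
  qed
  ultimately show ?thesis using that by (auto simp: rat_coeffs_def)
qed

section \<open>Uniqueness of the cubic subfield\<close>

context cyclotomic_generator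
begin

lemma fixed_field_subfield: "subfield (fixed_field d) complex_ring"
proof (rule subfield_complexI)
  show "1 \<in> fixed_field d" by (simp add: fixed_field_def Q_zeta_rat galois_funpow_rat)
next
  fix x assume x: "x \<in> fixed_field d"
  have "(galois ^^ d) ((-1) * x) = (-1) * x"
    using x by (subst galois_funpow_mult) (auto simp: fixed_field_def Q_zeta_rat galois_funpow_rat)
  thus "- x \<in> fixed_field d" using x by (simp add: fixed_field_def Q_zeta_uminus)
  assume "x \<noteq> 0"
  have "(galois ^^ d) (x * inverse x) = (galois ^^ d) x * (galois ^^ d) (inverse x)"
    using x by (intro galois_funpow_mult Q_zeta_inverse) (auto simp: fixed_field_def)
  hence "1 = x * (galois ^^ d) (inverse x)"
    using \<open>x \<noteq> 0\<close> x by (simp add: galois_funpow_rat fixed_field_def)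
  hence "(galois ^^ d) (inverse x) = inverse x" using \<open>x \<noteq> 0\<close> by (simp add: field_simps)
  thus "inverse x \<in> fixed_field d" using x by (simp add: fixed_field_def Q_zeta_inverse)
qed (auto simp: fixed_field_def Q_zeta_add Q_zeta_mult galois_funpow_add galois_funpow_mult)

lemma Q_zeta_subfield: "subfield Q_zeta complex_ring"
  by (rule subfield_complexI) (auto simp: Q_zeta_rat Q_zeta_uminus Q_zeta_add Q_zeta_mult Q_zeta_inverse)

lemma cyclotomic_field_eq: "cyclotomic_field p = Q_zeta"
proof
  show "cyclotomic_field p \<subseteq> Q_zeta"
    unfolding cyclotomic_field_def
    by (intro field.generate_field_min_subfield1[OF field_complex_ring] Q_zeta_subfield) (use Q_zeta_zeta_power[of 1] in auto)
  have "subfield (cyclotomic_field p) complex_ring"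
    unfolding cyclotomic_field_def by (intro field.generate_field_is_subfield[OF field_complex_ring]) auto
  moreover have "zeta p \<in> cyclotomic_field p"
    unfolding cyclotomic_field_def by (intro generate_field.incl) auto
  ultimately show "Q_zeta \<subseteq> cyclotomic_field p"
    by (auto elim!: Q_zeta_cases intro: subfield_poly_closed)
qed

lemma fixed_field_dimension:
  assumes d: "d dvd p - 1" shows "CR.dimension d \<rat> (fixed_field d)"
proof -
  have d0: "d > 0" using d p_gt_1 by (auto intro!: Nat.gr0I)
  define Us where "Us = map (period d) [0..<d]"
  have comb: "CR.combine Ks Us = (\<Sum>i<d. Ks ! i * period d i)" if "length Ks = d" for Ks
    using combine_complex_ring[of Ks Us] that by (simp add: Us_def)
  have "CR.independent \<rat> Us"
  proof (rule ccontr)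
    assume "\<not> CR.independent \<rat> Us"
    then obtain Ks where Ks: "length Ks = length Us" "CR.combine Ks Us = 0" "set Ks \<subseteq> \<rat>" "set Ks \<noteq> {0}"
      using CR.dependent_imp_non_trivial_combine[OF subfield_Rats, of Us] by auto
    have len: "length Ks = d" using Ks(1) by (simp add: Us_def)
    have "(\<Sum>i<d. nth_default 0 Ks i * period d i) = 0"
      using Ks(2) comb[OF len] len by (simp add: nth_default_def)
    hence "nth_default 0 Ks i = 0" if "i < d" for i
      using periods_independent[OF d, of "nth_default 0 Ks" i] Ks(3) that
      by (force simp: nth_default_def len)
    hence "\<forall>x\<in>set Ks. x = 0" by (auto simp: in_set_conv_nth len nth_default_def)
    thus False using Ks(4) len d0 by (metis length_greater_0_conv list.set_sel(1) insertI1 subset_antisym subsetI singletonD singletonI)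
  qed
  moreover have "CR.Span \<rat> Us = fixed_field d"
  proof
    show "CR.Span \<rat> Us \<subseteq> fixed_field d"
    proof
      fix x assume "x \<in> CR.Span \<rat> Us"
      then obtain Ks where Ks: "set Ks \<subseteq> \<rat>" "length Ks = d" "x = CR.combine Ks Us"
        using CR.Span_mem_iff_length_version[OF subfield_Rats, of Us x] by (auto simp: Us_def)
      have mem: "Ks ! i * period d i \<in> fixed_field d" if "i < d" for i
        using that Ks(1,2) Rats_subset_subfield[OF fixed_field_subfield]
        by (intro subfield_complexD(5)[OF fixed_field_subfield] period_in_fixed_field d)
          (meson nth_mem subsetD)
      have "(\<Sum>i<n. Ks ! i * period d i) \<in> fixed_field d" if "n \<le> d" for n
        using that by (induction n) (auto intro!: subfield_complexD[OF fixed_field_subfield] mem)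
      thus "x \<in> fixed_field d" using Ks comb by simp
    qed
    show "fixed_field d \<subseteq> CR.Span \<rat> Us"
    proof
      fix x assume "x \<in> fixed_field d"
      then obtain a where a: "\<And>i. a i \<in> \<rat>" "x = (\<Sum>i<d. a i * period d i)"
        using fixed_field_span[OF d] by blast
      have "x = CR.combine (map a [0..<d]) Us" using a(2) by (simp add: comb)
      thus "x \<in> CR.Span \<rat> Us"
        using CR.Span_mem_iff_length_version[OF subfield_Rats, of Us x] a(1)
        by (auto simp: Us_def intro!: exI[of _ "map a [0..<d]"])
    qed
  qed
  ultimately show ?thesis
    using CR.dimensionI[OF subfield_Rats, of Us] by (simp add: Us_def)
qed

lemma galois_funpow_poly:
  assumes f: "rat_coeffs f" and x: "x \<in> Q_zeta"
  shows "(galois ^^ n) (poly f x) = poly f ((galois ^^ n) x)"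
  using f
proof (induction f)
  case (pCons a f)
  thus ?case
    using subfield_poly_closed[OF Q_zeta_subfield _ x, of f] x
    by (simp add: rat_coeffs_pCons galois_funpow_add galois_funpow_mult galois_funpow_rat Q_zeta_rat Q_zeta_mult)
qed (simp add: galois_funpow_rat)

text \<open>
  An element \<open>x\<close> of a cubic field has at most three conjugates, so two of
  \<open>x, galois x, galois (galois x), (galois ^^ 3) x\<close> agree, and \<open>x\<close> is fixed by the first, second or third
  power of the automorphism. Elements fixed by the first power are fixed by all of them.
\<close>

lemma cubic_element_fixed:
  assumes K: "subfield K complex_ring" "CR.dimension 3 \<rat> K" "K \<subseteq> Q_zeta" and x: "x \<in> K"
  shows "x \<in> fixed_field 2 \<or> x \<in> fixed_field 3"
proof -
  have xQ: "x \<in> Q_zeta" using K x by blast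
  obtain f where f: "rat_coeffs f" "f \<noteq> 0" "Polynomial.degree f \<le> 3" "poly f x = 0"
    using algebraic_over_Rats_of_dimension[OF K(1,2) x] .
  have "poly f ((galois ^^ n) x) = 0" for n
    using galois_funpow_poly[OF f(1) xQ, of n] f(4) by (simp add: galois_funpow_rat)
  hence "(\<lambda>n. (galois ^^ n) x) ` {..<4} \<subseteq> {z. poly f z = 0}" by auto
  hence "card ((\<lambda>n. (galois ^^ n) x) ` {..<4}) \<le> card {z. poly f z = 0}"
    by (rule card_mono[OF poly_roots_finite[OF f(2)]])
  also have "\<dots> \<le> 3" using card_poly_roots_bound[OF f(2)] f(3) by simp
  finally have "\<not> inj_on (\<lambda>n. (galois ^^ n) x) {..<4::nat}"
    using card_image by fastforce
  then obtain i j :: nat where ij: "i < j" "j < 4" "(galois ^^ i) x = (galois ^^ j) x"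
    unfolding inj_on_def by (metis lessThan_iff linorder_neqE_nat)
  define d where "d = j - i"
  have d: "d = 1 \<or> d = 2 \<or> d = 3" using ij by (auto simp: d_def)
  have "(galois ^^ i) ((galois ^^ d) x) = (galois ^^ i) x"
    using ij by (simp add: d_def flip: funpow_add comp_apply[of "galois ^^ i"]) 
  hence "(galois ^^ d) x = x" using galois_funpow_inj galois_funpow_closed xQ by blast
  thus ?thesis using d xQ by (auto simp: fixed_field_def numeral_2_eq_2)
qed

text \<open>
  By the previous lemma a cubic subfield \<open>K\<close> is the union of its intersections with the fixed fields of
  \<open>galois ^^ 2\<close> and \<open>galois ^^ 3\<close>. An additive group is not the union of two proper subgroups, so \<open>K\<close>
  lies in one of these fields; the first is only quadratic, and in the second dimensions agree.
\<close>

lemma cubic_subfield_unique: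
  assumes six: "6 dvd p - 1"
    and K: "subfield K complex_ring" "K \<subseteq> Q_zeta" "CR.dimension 3 \<rat> K"
  shows "K = fixed_field 3"
proof -
  have d: "2 dvd p - 1" "3 dvd p - 1"
    using six by presburger+
  obtain Vs where Vs: "CR.independent \<rat> Vs" "length Vs = 3" "CR.Span \<rat> Vs = K"
    using CR.exists_base[OF subfield_Rats K(3)] by blast
  have VsK: "set Vs \<subseteq> K" using CR.Span_base_incl[OF subfield_Rats, of Vs] Vs by simp
  have "\<not> K \<subseteq> fixed_field 2"
    using CR.independent_length_le_dimension[OF subfield_Rats fixed_field_dimension[OF d(1)] Vs(1)]
      Vs(2) VsK by fastforce
  then obtain a where a: "a \<in> K" "a \<notin> fixed_field 2" by blast
  have sub: "K \<subseteq> fixed_field 3"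
  proof
    fix b assume b: "b \<in> K"
    note each = cubic_element_fixed[OF K(1,3,2)]
    show "b \<in> fixed_field 3"
    proof (rule ccontr)
      assume nb: "b \<notin> fixed_field 3"
      hence b2: "b \<in> fixed_field 2" and a3: "a \<in> fixed_field 3" using each a b by blast+
      have "a + b \<in> K" using a b by (intro subfield_complexD[OF K(1)])
      with each consider "a + b \<in> fixed_field 2" | "a + b \<in> fixed_field 3" by blast
      thus False
      proof cases
        case 1
        hence "(a + b) + (- b) \<in> fixed_field 2"
          using b2 by (rule subfield_complexD(4)[OF fixed_field_subfield _
              subfield_complexD(3)[OF fixed_field_subfield]])
        thus False using a by simp
      next
        case 2
        hence "(a + b) + (- a) \<in> fixed_field 3"
          using a3 by (rule subfield_complexD(4)[OF fixed_field_subfield _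
              subfield_complexD(3)[OF fixed_field_subfield]])
        thus False using nb by simp
      qed
    qed
  qed
  have "CR.Span \<rat> Vs = fixed_field 3"
    using CR.independent_length_eq_dimension[OF subfield_Rats fixed_field_dimension[OF d(2)] Vs(1)]
      VsK sub Vs(2) by auto
  thus ?thesis using Vs by simp
qed

lemma cubic_subfield_eq:
  assumes six: "6 dvd p - 1" shows "cubic_subfield p = fixed_field 3"
proof -
  have "3 dvd p - 1" using six by presburger
  thus ?thesis
    unfolding cubic_subfield_def cyclotomic_field_eq
    by (intro the_equality)
      (auto simp: fixed_field_subfield fixed_field_dimension cubic_subfield_unique[OF six],
       auto simp: fixed_field_def)
qed

end

section \<open>Products of sines as products of conjugates\<close>

lemma zeta_nonzero: "zeta p \<noteq> 0"
  by (simp add: zeta_def)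

lemma zeta_inj_on: "p > 0 \<Longrightarrow> inj_on (\<lambda>k. zeta p ^ k) {..<p}"
proof (rule linorder_inj_onI)
  fix a b assume p: "p > 0" and ab: "a < b" "a \<in> {..<p}" "b \<in> {..<p}"
  show "zeta p ^ a \<noteq> zeta p ^ b"
  proof
    assume "zeta p ^ a = zeta p ^ b"
    moreover have "zeta p ^ b = zeta p ^ a * zeta p ^ (b - a)"
      using ab by (simp flip: power_add)
    ultimately have "zeta p ^ (b - a) = 1" using zeta_nonzero[of p] by simp
    hence "p dvd b - a" using zeta_power_eq_1_iff[OF p] by blast
    thus False using ab by (auto dest!: dvd_imp_le)
  qed
qed auto

text \<open>
  Evaluate \<open>\<Prod>(X - \<zeta>\<^sup>k) = 1 + X + \<dots> + X\<^bsup>p-1\<^esup>\<close> at \<open>X = 1\<close>.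
\<close>

lemma prod_one_minus_zeta_power:
  assumes "p > 1"
  shows "(\<Prod>k\<in>{1..<p}. 1 - zeta p ^ k) = of_nat p"
proof -
  define F where "F = (\<Prod>k\<in>{1..<p}. [:- (zeta p ^ k), 1:])"
  define G where "G = (\<Sum>k<p. Polynomial.monom (1 :: complex) k)"
  have polyF: "poly F z = (\<Prod>k\<in>{1..<p}. z - zeta p ^ k)" for z
    by (simp add: F_def poly_prod)
  have polyG: "poly G z = (\<Sum>k<p. z ^ k)" for z
    by (simp add: G_def poly_sum poly_monom)
  have coeffG: "poly.coeff G i = (if i < p then 1 else 0)" for i
    by (simp add: G_def coeff_sum)
  have degF: "Polynomial.degree F = p - 1"
    unfolding F_def by (subst degree_prod_eq_sum_degree) auto
  have "Polynomial.lead_coeff F = 1"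
    unfolding F_def by (simp add: lead_coeff_prod)
  hence "F = G"
  proof (intro poly_eqI_degree_lead_coeff[where n = "p - 1" and A = "(\<lambda>k. zeta p ^ k) ` {1..<p}"])
    have "inj_on (\<lambda>k. zeta p ^ k) {1..<p}"
      using zeta_inj_on[of p] assms by (auto intro: inj_on_subset)
    thus "p - 1 \<le> card ((\<lambda>k. zeta p ^ k) ` {1..<p})" by (simp add: card_image)
    show "Polynomial.degree G \<le> p - 1" by (intro degree_le) (auto simp: coeffG)
    fix z assume "z \<in> (\<lambda>k. zeta p ^ k) ` {1..<p}"
    then obtain k where k: "k \<in> {1..<p}" "z = zeta p ^ k" by blast
    have "z \<noteq> 1" using zeta_power_eq_1_iff[of p k] k assms by (auto dest: dvd_imp_le)
    moreover have "z ^ p = 1"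
      using k assms zeta_power_eq_1_iff[of p "k * p"] by (simp add: power_mult)
    ultimately have "poly G z = 0" by (simp add: polyG geometric_sum)
    moreover have "poly F z = 0" using k by (auto simp: polyF)
    ultimately show "poly F z = poly G z" by simp
  qed (use assms degF coeffG in auto)
  hence "poly F 1 = poly G 1" by simp
  thus ?thesis by (simp add: polyF polyG)
qed

lemma norm_one_minus_zeta_power: "norm (1 - zeta p ^ n) = 2 * \<bar>sin (pi * real n / real p)\<bar>"
proof -
  define t where "t = pi * real n / real p"
  have "zeta p ^ n = cis (2 * t)" by (simp add: zeta_power t_def mult_ac)
  hence "(norm (1 - zeta p ^ n))\<^sup>2 = (1 - cos (2 * t))\<^sup>2 + (sin (2 * t))\<^sup>2"
    by (simp add: cmod_power2)
  also have "\<dots> = 2 - 2 * cos (2 * t)"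
    using sin_cos_squared_add[of "2 * t"] by (simp add: power2_eq_square algebra_simps)
  also have "\<dots> = (2 * \<bar>sin t\<bar>)\<^sup>2"
    by (simp add: cos_double_sin power_mult_distrib)
  finally show ?thesis unfolding t_def by (rule power2_eq_imp_eq) auto
qed

lemma cnj_zeta_power:
  assumes "p > 0" shows "cnj (zeta p ^ k) = zeta p ^ ((p - 1) * k)"
proof -
  have "zeta p ^ k * zeta p ^ ((p - 1) * k) = zeta p ^ (p * k)"
    using assms by (cases p) (simp_all flip: power_add)
  also have "\<dots> = 1" using zeta_power_eq_1_iff[OF assms] by simp
  finally have "zeta p ^ k * zeta p ^ ((p - 1) * k) = 1" .
  moreover have "zeta p ^ k * cnj (zeta p ^ k) = 1"
    by (simp add: zeta_power cis_cnj cis_mult del: complex_cnj_power)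
  ultimately show ?thesis using zeta_nonzero[of p]
    by (metis mult_cancel_left power_not_zero)
qed

locale cubic_generator = cyclotomic_generator +
  fixes m :: nat
  assumes p_eq: "p = 6 * m + 1"
begin

lemma m_pos: "m > 0" using p_eq p_gt_1 by simp

text \<open>
  Modulo \<open>p = 6 * m + 1\<close>, the number \<open>3 * m + 1\<close> is the inverse of 2 and \<open>p - 1\<close> is \<open>-1\<close>; so this is
  \<open>\<zeta>\<^bsup>-n/2\<^esup> - \<zeta>\<^bsup>n/2\<^esup>\<close> with the square roots taken inside the cyclotomic field. Up to a fourth root of unity
  it is \<open>2 sin (\<pi> n / p)\<close>, and unlike \<open>1 - \<zeta>\<^sup>n\<close> it changes only its sign under \<open>n \<mapsto> -n\<close>.
\<close>

definition zeta_diff :: "nat \<Rightarrow> complex" where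
  "zeta_diff n = zeta p ^ ((p - 1) * ((3 * m + 1) * n)) - zeta p ^ ((3 * m + 1) * n)"

lemma zeta_diff_in_Q_zeta: "zeta_diff n \<in> Q_zeta"
  unfolding zeta_diff_def by (intro Q_zeta_diff Q_zeta_zeta_power)

lemma galois_zeta_diff: "galois (zeta_diff n) = zeta_diff (n * g)"
  by (simp only: zeta_diff_def galois_diff Q_zeta_zeta_power galois_zeta_power mult.assoc)

lemma zeta_diff_cong: "[a = b] (mod p) \<Longrightarrow> zeta_diff a = zeta_diff b"
  unfolding zeta_diff_def by (intro arg_cong2[where f = "(-)"] zeta_power_cong p_gt_0 cong_mult) auto

lemma cnj_zeta_diff: "cnj (zeta_diff n) = - zeta_diff n"
proof -
  have "cnj (zeta p ^ ((p - 1) * k)) = zeta p ^ k" for k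
    using cnj_zeta_power[OF p_gt_0, of k] by (metis complex_cnj_cnj)
  thus ?thesis using cnj_zeta_power[OF p_gt_0] by (simp add: zeta_diff_def del: complex_cnj_power)
qed

lemma zeta_diff_uminus: "zeta_diff ((p - 1) * n) = - zeta_diff n"
proof -
  have "(p - 1) * ((3 * m + 1) * ((p - 1) * n)) = (3 * m + 1) * n + p * ((6 * m - 1) * (3 * m + 1) * n)"
    using m_pos by (cases m) (simp_all add: p_eq algebra_simps)
  hence "zeta p ^ ((p - 1) * ((3 * m + 1) * ((p - 1) * n))) = zeta p ^ ((3 * m + 1) * n)"
    by (intro zeta_power_cong p_gt_0) (simp only: cong_def mod_mult_self2)
  moreover have "(3 * m + 1) * ((p - 1) * n) = (p - 1) * ((3 * m + 1) * n)"
    by (rule mult.left_commute)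
  ultimately show ?thesis by (simp add: zeta_diff_def)
qed

lemma norm_zeta_diff: "norm (zeta_diff n) = norm (1 - zeta p ^ n)"
proof -
  have "(p - 1) * ((3 * m + 1) * n) + n = (3 * m + 1) * n + p * (3 * m * n)"
    by (simp add: p_eq algebra_simps)
  hence "zeta p ^ ((p - 1) * ((3 * m + 1) * n) + n) = zeta p ^ ((3 * m + 1) * n)"
    by (intro zeta_power_cong p_gt_0) (simp only: cong_def mod_mult_self2)
  hence "zeta_diff n = zeta p ^ ((p - 1) * ((3 * m + 1) * n)) * (1 - zeta p ^ n)"
    by (simp only: zeta_diff_def right_diff_distrib power_add mult_1_right)
  moreover have "norm (zeta p ^ k) = 1" for k by (simp add: zeta_power del: norm_power)
  ultimately show ?thesis by (simp add: norm_mult del: norm_power)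
qed

lemma norm_zeta_diff_sin:
  assumes "n < p" shows "norm (zeta_diff n) = 2 * sin (pi * real n / real p)"
proof -
  have "pi * real n / real p \<le> pi"
    using assms p_gt_0 by (simp add: field_simps)
  hence "sin (pi * real n / real p) \<ge> 0" by (intro sin_ge_zero) auto
  thus ?thesis by (simp add: norm_zeta_diff norm_one_minus_zeta_power)
qed

lemma zeta_diff_generator_nonzero: "zeta_diff (g ^ n) \<noteq> 0"
  using norm_zeta_diff[of "g ^ n"] zeta_power_eq_1_iff[OF p_gt_0, of "g ^ n"] not_dvd_generator_power
  by auto

text \<open>
  The power \<open>g\<^bsup>3m\<^esup> = g\<^bsup>(p-1)/2\<^esup>\<close> is a square root of 1 modulo \<open>p\<close> other than 1, hence \<open>-1\<close>.
\<close>

lemma generator_half_period: "[g ^ (n + 3 * m) = (p - 1) * g ^ n] (mod p)"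
proof -
  have p1: "p - 1 = 3 * m + 3 * m" by (simp add: p_eq)
  define x where "x = int (g ^ (3 * m))"
  have "[g ^ (0 + (p - 1) * 1) = g ^ 0] (mod p)" by (rule generator_power_period)
  hence "[g ^ (3 * m) * g ^ (3 * m) = 1] (mod p)" unfolding p1 by (simp flip: power_add)
  hence "[x * x = 1] (mod int p)" unfolding x_def by (metis cong_int_iff of_nat_mult of_nat_1)
  hence "int p dvd (x - 1) * (x + 1)" by (simp add: cong_iff_dvd_diff algebra_simps)
  hence "int p dvd x - 1 \<or> int p dvd x + 1" using prime_p by (simp add: prime_dvd_mult_iff)
  moreover have "\<not> int p dvd x - 1"
  proof
    assume "int p dvd x - 1"
    hence "[g ^ (3 * m) = g ^ 0] (mod p)"
      unfolding x_def by (simp add: cong_iff_dvd_diff flip: cong_int_iff)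
    hence "g ^ (3 * m) mod p = g ^ 0 mod p" by (simp add: cong_def)
    moreover have "3 * m \<in> {..<p-1}" "0 \<in> {..<p-1}" using m_pos p1 by auto
    ultimately have "3 * m = 0" using generator_bij unfolding bij_betw_def inj_on_def by blast
    thus False using m_pos by simp
  qed
  ultimately have "int p dvd x + 1" by blast
  hence "int p dvd (x + 1) - int p" by simp
  hence "[x = int (p - 1)] (mod int p)"
    using p_gt_0 by (simp add: cong_iff_dvd_diff of_nat_diff algebra_simps)
  hence "[g ^ (3 * m) = p - 1] (mod p)" unfolding x_def cong_int_iff .
  hence "[g ^ n * g ^ (3 * m) = g ^ n * (p - 1)] (mod p)" by (intro cong_mult) auto
  thus ?thesis by (simp add: power_add mult.commute)
qed

lemma zeta_diff_half_period: "zeta_diff (g ^ (n + 3 * m)) = - zeta_diff (g ^ n)"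
  using zeta_diff_cong[OF generator_half_period] zeta_diff_uminus by simp

text \<open>
  The numbers \<open>g\<^bsup>3k+j\<^esup>\<close> represent the coset of \<open>g\<^sup>j\<close> modulo sign, since \<open>g\<^bsup>3m\<^esup>\<close> is \<open>-1\<close>. The square is up to
  sign the norm of \<open>1 - \<zeta>\<^bsup>g\<^sup>j\<^esup>\<close> to the cubic subfield.
\<close>

definition half_norm :: "nat \<Rightarrow> complex" where
  "half_norm j = (\<Prod>k<m. zeta_diff (g ^ (3 * k + j)))"

lemma half_norm_nonzero: "half_norm j \<noteq> 0"
  by (simp add: half_norm_def zeta_diff_generator_nonzero)

lemma half_norm_in_Q_zeta: "half_norm j \<in> Q_zeta"
  unfolding half_norm_def by (intro Q_zeta_prod zeta_diff_in_Q_zeta)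

lemma galois_half_norm: "galois (half_norm j) = half_norm (j + 1)"
  unfolding half_norm_def by (subst galois_prod) (auto simp: zeta_diff_in_Q_zeta galois_zeta_diff mult_ac)

text \<open>
  Shifting \<open>k\<close> by one exchanges the factor with exponent \<open>g\<^sup>j\<close> for the one with \<open>g\<^bsup>j+3m\<^esup> = -g\<^sup>j\<close>. This
  sign keeps a single \<open>half_norm j\<close> out of the cubic subfield, but it cancels in a product of two.
\<close>

lemma half_norm_shift: "half_norm (j + 3) = - half_norm j"
proof -
  define f where "f = (\<lambda>k. zeta_diff (g ^ (3 * k + j)))"
  have fm: "f m = - f 0" using zeta_diff_half_period[of j] by (simp add: f_def add_ac)
  have "prod f {..<m} * f m = f 0 * (\<Prod>k<m. f (Suc k))"
    using prod.lessThan_Suc[of f m] prod.lessThan_Suc_shift[of f m] by simp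
  moreover have "(\<Prod>k<m. f (Suc k)) = half_norm (j + 3)" "prod f {..<m} = half_norm j"
    by (simp_all add: half_norm_def f_def add_ac)
  ultimately have "f 0 * half_norm (j + 3) = f 0 * (- half_norm j)" using fm by (simp add: mult.commute)
  moreover have "f 0 \<noteq> 0" by (simp add: f_def zeta_diff_generator_nonzero)
  ultimately show ?thesis by (metis mult_left_cancel)
qed

lemma half_norm_mult_fixed: "half_norm i * half_norm j \<in> fixed_field 3"
proof -
  have shift: "(galois ^^ 3) (half_norm j) = - half_norm j" for j
    using half_norm_shift[of j] by (simp add: numeral_3_eq_3 galois_half_norm)
  have "(galois ^^ 3) (half_norm i * half_norm j) = half_norm i * half_norm j"
    by (subst galois_funpow_mult) (auto simp: half_norm_in_Q_zeta shift)
  thus ?thesis by (simp add: fixed_field_def Q_zeta_mult half_norm_in_Q_zeta)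
qed

text \<open>
  Each factor \<open>zeta_diff n\<close> is purely imaginary and the product has an even number of them, so it is
  real and differs from its absolute value at most by a sign.
\<close>

lemma norm_half_norm_mult_fixed: "complex_of_real (norm (half_norm i * half_norm j)) \<in> fixed_field 3"
proof -
  define x where "x = half_norm i * half_norm j"
  have cnj: "cnj (half_norm j) = (-1) ^ m * half_norm j" for j
    by (simp add: half_norm_def cnj_zeta_diff prod_uminus)
  have "((-1) ^ m * (-1) ^ m :: complex) = 1" by (simp flip: power_mult_distrib)
  hence "cnj x = x" by (simp add: x_def cnj mult_ac) 
  hence "x \<in> \<real>" by (simp add: Reals_cnj_iff)
  then obtain r where r: "x = complex_of_real r" by (auto elim: Reals_cases)
  hence "complex_of_real (norm x) = x \<or> complex_of_real (norm x) = - x"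
    by (cases "r \<ge> 0") auto
  moreover have "x \<in> fixed_field 3" unfolding x_def by (rule half_norm_mult_fixed)
  ultimately show ?thesis
    unfolding x_def[symmetric] using subfield_complexD(3)[OF fixed_field_subfield] by metis
qed

text \<open>
  The square of the left-hand side is the product of \<open>|1 - \<zeta>\<^sup>k|\<close> over all nonzero residues \<open>k\<close>, because
  \<open>k\<close> and \<open>-k\<close> contribute equally.
\<close>

lemma norm_prod_half_norm: "norm (half_norm 0 * half_norm 1 * half_norm 2) = sqrt (real p)"
proof -
  define f where "f = (\<lambda>n. norm (zeta_diff (g ^ n)))"
  have f: "f (n + 3 * m) = f n" for n by (simp add: f_def zeta_diff_half_period)
  have H: "norm (half_norm j) = (\<Prod>k<m. f (j + 3 * k))" for j
    by (simp add: half_norm_def prod_norm f_def add_ac)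
  have "{..<3::nat} = {0,1,2}" by auto
  hence half: "norm (half_norm 0 * half_norm 1 * half_norm 2) = prod f {..<3*m}"
    using prod.lessThan_mult[of 3 f m] by (simp add: norm_mult H mult_ac)
  have "prod f {..<p-1} = prod f {..<(3*m)*2}" by (simp add: p_eq)
  also have "\<dots> = (\<Prod>n<3*m. \<Prod>j<2. f (n + 3 * m * j))"
    using m_pos by (intro prod.lessThan_mult) auto
  also have "\<dots> = (\<Prod>n<3*m. f n ^ 2)"
    by (intro prod.cong) (simp_all add: numeral_2_eq_2 f)
  finally have sq: "prod f {..<p-1} = (prod f {..<3*m})\<^sup>2" by (simp add: prod_power_distrib)
  have "prod f {..<p-1} = (\<Prod>n<p-1. norm (1 - zeta p ^ (g ^ n mod p)))"
    unfolding f_def norm_zeta_diff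
    by (intro prod.cong refl arg_cong[where f = norm] arg_cong2[where f = "(-)"] zeta_power_cong p_gt_0)
      (auto simp: cong_def)
  also have "\<dots> = (\<Prod>k\<in>{1..<p}. norm (1 - zeta p ^ k))"
    by (rule prod.reindex_bij_betw[OF generator_bij])
  also have "\<dots> = norm (\<Prod>k\<in>{1..<p}. 1 - zeta p ^ k)" by (simp add: prod_norm)
  also have "\<dots> = real p" using prod_one_minus_zeta_power[OF p_gt_1] by simp
  finally have "(norm (half_norm 0 * half_norm 1 * half_norm 2))\<^sup>2 = real p"
    using sq half by simp
  thus ?thesis by (metis norm_ge_zero real_sqrt_unique)
qed

end

section \<open>The cosets of the cubic residues\<close>

lemma cubic_coset_cubes:
  assumes p: "Factorial_Ring.prime p" and C: "C \<in> cubic_cosets p"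
  obtains a where "0 < a" "a < int p" "C = {x ^ 3 * a mod int p | x. 0 < x \<and> x < int p}"
proof -
  have p1: "p > 1" using p prime_gt_1_nat by blast
  interpret residues "int p" "residue_ring (int p)"
    by unfold_locales (use p1 in auto)
  have coprime: "coprime x (int p)" if "0 < x" "x < int p" for x
    using that p zdvd_not_zless[of x "int p"] prime_imp_coprime_int[of "int p" x]
    by (simp add: coprime_commute)
  hence carrier: "carrier (residue_units p) = {x. 0 < x \<and> x < int p}"
    by (auto simp: residue_units_def units_of_carrier res_units_eq)
  have mult: "x \<otimes>\<^bsub>residue_units p\<^esub> y = (x * y) mod int p" for x y
    by (simp add: residue_units_def units_of_mult res_mult_eq)
  have cube: "x [^]\<^bsub>residue_units p\<^esub> (3::nat) = x ^ 3 mod int p"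
    if "0 < x" "x < int p" for x
  proof -
    have "x [^]\<^bsub>residue_units p\<^esub> (3::nat) = x [^]\<^bsub>residue_ring (int p)\<^esub> (3::nat)"
      using that coprime by (simp add: residue_units_def units_of_pow res_units_eq)
    also have "\<dots> = (x mod int p) [^]\<^bsub>residue_ring (int p)\<^esub> (3::nat)"
      using that by simp
    finally show ?thesis by (simp only: pow_cong)
  qed
  obtain a where a: "a \<in> carrier (residue_units p)"
    and C': "C = cubic_residues p #>\<^bsub>residue_units p\<^esub> a"
    using C by (auto simp: cubic_cosets_def RCOSETS_def)
  have "C = (\<lambda>x. x ^ 3 * a mod int p) ` {x. 0 < x \<and> x < int p}"
    unfolding C' cubic_residues_def r_coset_def carrier UNION_singleton_eq_range image_image
    by (intro image_cong refl) (auto simp: mult cube mod_mult_left_eq)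
  thus ?thesis using that[of a] a by (auto simp: carrier image_def)
qed

context cubic_generator
begin

text \<open>
  The coset of \<open>g\<^sup>i\<close>. All natural numbers \<open>k\<close> are admitted, though those below \<open>2 * m\<close> already give each
  element once; so membership needs no reduction of exponents.
\<close>

definition cubic_class :: "nat \<Rightarrow> int set" where
  "cubic_class i = range (\<lambda>k. int (g ^ (3 * k + i) mod p))"

lemma generator_power_cover:
  assumes "0 < a" "a < int p" obtains n where "a = int (g ^ n mod p)"
proof -
  have "nat a \<in> (\<lambda>i. g ^ i mod p) ` {..<p-1}"
    using generator_bij assms by (auto simp: bij_betw_def)
  then obtain n where "nat a = g ^ n mod p" by blast
  thus ?thesis using that[of n] assms by simp
qed

lemma generator_power_mod_cong: "g ^ (n + 6 * m * k) mod p = g ^ n mod p"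
  using generator_power_period[of n k] by (simp add: cong_def p_eq)

lemma cubic_class_mod: "cubic_class (j mod 3) = cubic_class j"
proof -
  have 1: "\<exists>l. g ^ (3 * k + j mod 3) mod p = g ^ (3 * l + j) mod p" for k
  proof -
    define q where "q = j div 3"
    have "2 * m * q \<ge> q" using m_pos by (cases m) auto
    then obtain r where r: "2 * m * q = q + r" using le_Suc_ex by blast
    hence "6 * m * q = 3 * q + 3 * r" by simp
    hence "(3 * k + j mod 3) + 6 * m * q = 3 * (k + r) + (3 * q + j mod 3)" by simp
    hence "3 * (k + r) + j = (3 * k + j mod 3) + 6 * m * q" by (simp add: q_def)
    hence "g ^ (3 * (k + r) + j) mod p = g ^ (3 * k + j mod 3) mod p"
      by (simp only: generator_power_mod_cong)
    thus ?thesis by metis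
  qed
  have 2: "\<exists>l. g ^ (3 * k + j) mod p = g ^ (3 * l + j mod 3) mod p" for k
  proof -
    have "3 * k + j = 3 * (k + j div 3) + j mod 3" by simp
    thus ?thesis by metis
  qed
  show ?thesis unfolding cubic_class_def
  proof (intro equalityI image_subsetI)
    fix k
    obtain l where l: "g ^ (3 * k + j mod 3) mod p = g ^ (3 * l + j) mod p" using 1 by blast
    show "int (g ^ (3 * k + j mod 3) mod p) \<in> range (\<lambda>k. int (g ^ (3 * k + j) mod p))"
      unfolding l by (rule rangeI)
  next
    fix k
    obtain l where l: "g ^ (3 * k + j) mod p = g ^ (3 * l + j mod 3) mod p" using 2 by blast
    show "int (g ^ (3 * k + j) mod p) \<in> range (\<lambda>k. int (g ^ (3 * k + j mod 3) mod p))"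
      unfolding l by (rule rangeI)
  qed
qed

lemma cubic_coset_cubic_class:
  assumes "C \<in> cubic_cosets p" obtains i where "i < 3" "C = cubic_class i"
proof -
  obtain a where a: "0 < a" "a < int p" and C: "C = {x ^ 3 * a mod int p | x. 0 < x \<and> x < int p}"
    using cubic_coset_cubes[OF prime_p assms] .
  obtain j where j: "a = int (g ^ j mod p)"
    using a generator_power_cover by blast
  have elem: "int (g ^ k mod p) ^ 3 * a mod int p = int (g ^ (3 * k + j) mod p)" for k
  proof -
    have "int (g ^ k mod p) ^ 3 * a mod int p = int ((g ^ k) ^ 3 * g ^ j) mod int p"
      unfolding j of_nat_mult of_nat_power[of "g ^ k" 3] zmod_int
      by (rule cong_mult[THEN cong_def[THEN iffD1]]) (simp_all add: cong_def power_mod)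
    also have "(g ^ k) ^ 3 * g ^ j = g ^ (3 * k + j)"
      by (simp add: power_add mult.commute flip: power_mult)
    finally show ?thesis by (simp only: zmod_int)
  qed
  have "C = cubic_class j"
  proof (intro equalityI subsetI)
    fix y assume "y \<in> C"
    then obtain x where x: "0 < x" "x < int p" "y = x ^ 3 * a mod int p" unfolding C by blast
    obtain k where "x = int (g ^ k mod p)" using x generator_power_cover by blast
    thus "y \<in> cubic_class j" using x elem by (auto simp: cubic_class_def)
  next
    fix y assume "y \<in> cubic_class j"
    then obtain k where k: "y = int (g ^ (3 * k + j) mod p)" by (auto simp: cubic_class_def)
    have "0 < int (g ^ k mod p)" "int (g ^ k mod p) < int p"
      using not_dvd_generator_power[of k] p_gt_0 by (auto simp: dvd_eq_mod_eq_0)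
    thus "y \<in> C" unfolding C k elem[symmetric] by blast
  qed
  hence "C = cubic_class (j mod 3)" by (simp add: cubic_class_mod)
  thus ?thesis using that[of "j mod 3"] by simp
qed

lemma generator_power_mod_inj:
  assumes "g ^ a mod p = g ^ b mod p" "a < 6 * m" "b < 6 * m" shows "a = b"
  using generator_bij assms unfolding bij_betw_def inj_on_def by (auto simp: p_eq)

lemma generator_power_mod_half: "g ^ (n + 3 * m) mod p = p - g ^ n mod p"
proof -
  have "g ^ n mod p \<noteq> 0" using not_dvd_generator_power[of n] by (simp add: dvd_eq_mod_eq_0)
  moreover have lt: "g ^ n mod p < p" using p_gt_0 by simp
  have "(p - 1) * g ^ n mod p = (p - 1) * (g ^ n mod p) mod p" by (simp add: mod_simps)
  moreover have "(p - 1) * x mod p = p - x" if "x \<noteq> 0" "x < p" for x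
  proof -
    have "(p - 1) * x = p * (x - 1) + (p - x)"
      using that by (cases x) (auto simp: algebra_simps diff_mult_distrib)
    hence "(p - 1) * x mod p = (p - x) mod p" by (simp only: mod_mult_self4)
    thus ?thesis using that by simp
  qed
  ultimately show ?thesis using generator_half_period[of n] lt by (simp add: cong_def)
qed

text \<open>
  Of each pair \<open>\<plusminus>r\<close> of residues in the coset, the half coset contains the representative below \<open>p / 2\<close>.
  The pairs correspond to \<open>k < m\<close>, since adding \<open>m\<close> to \<open>k\<close> changes the sign of \<open>g\<^bsup>3k+i\<^esup>\<close>.
\<close>

lemma half_coset_bij:
  assumes i: "i < 3"
  shows "bij_betw (\<lambda>k. int (min (g ^ (3 * k + i) mod p) (p - g ^ (3 * k + i) mod p)))
           {..<m} (half_coset p (cubic_class i))"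
proof -
  define G where "G = (\<lambda>k. g ^ (3 * k + i) mod p)"
  have G0: "0 < G k" "G k < p" for k
    using not_dvd_generator_power[of "3 * k + i"] p_gt_0
    by (auto simp: G_def dvd_eq_mod_eq_0)
  have G_half: "G (k + m) = p - G k" for k
    using generator_power_mod_half[of "3 * k + i"] by (simp add: G_def algebra_simps)
  have G_period: "G (k + 2 * m * l) = G k" for k l
    using generator_power_mod_cong[of "3 * k + i" l] by (simp add: G_def algebra_simps)
  have G_inj: "a = b" if "G a = G b" "a < 2 * m" "b < 2 * m" for a b
    using generator_power_mod_inj[of "3 * a + i" "3 * b + i"] that i by (simp add: G_def)
  have odd: "2 * a \<noteq> p" for a using p_eq by presburger
  have half: "half_coset p (cubic_class i) = {a. 1 \<le> a \<and> 2 * a < int p \<and> a \<in> range (\<lambda>k. int (G k))}"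
  proof -
    have "real_of_int a < real p / 2 \<longleftrightarrow> 2 * a < int p" for a by linarith
    thus ?thesis by (auto simp: half_coset_def cubic_class_def G_def)
  qed
  have "bij_betw (\<lambda>k. int (min (G k) (p - G k))) {..<m} (half_coset p (cubic_class i))"
    unfolding bij_betw_def
  proof
    show "inj_on (\<lambda>k. int (min (G k) (p - G k))) {..<m}"
    proof (rule inj_onI)
      fix a b assume ab: "a \<in> {..<m}" "b \<in> {..<m}" "int (min (G a) (p - G a)) = int (min (G b) (p - G b))"
      hence "G a = G b \<or> G a = p - G b" using G0[of a] G0[of b] by linarith
      thus "a = b"
      proof
        assume "G a = G b" thus ?thesis using G_inj[of a b] ab(1,2) by simp
      next
        assume "G a = p - G b"
        hence "G a = G (b + m)" by (simp add: G_half)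
        thus ?thesis using G_inj[of a "b + m"] ab(1,2) by simp
      qed
    qed
    show "(\<lambda>k. int (min (G k) (p - G k))) ` {..<m} = half_coset p (cubic_class i)"
    proof (intro equalityI subsetI)
      fix x assume "x \<in> (\<lambda>k. int (min (G k) (p - G k))) ` {..<m}"
      then obtain k where k: "x = int (min (G k) (p - G k))" by blast
      hence "x = int (G k) \<or> x = int (G (k + m))" by (auto simp: G_half min_def)
      moreover have "1 \<le> x" "2 * x < int p" using G0[of k] odd[of "G k"] unfolding k by linarith+
      ultimately show "x \<in> half_coset p (cubic_class i)" by (auto simp: half)
    next
      fix x assume "x \<in> half_coset p (cubic_class i)"
      then obtain k where k: "x = int (G k)" "2 * G k < p" by (auto simp: half)
      define k' where "k' = k mod (2 * m)"
      have "G k = G k'" using G_period[of k' "k div (2 * m)"] by (simp add: k'_def)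
      have "k' < 2 * m" using m_pos by (simp add: k'_def)
      show "x \<in> (\<lambda>k. int (min (G k) (p - G k))) ` {..<m}"
      proof (cases "k' < m")
        case True
        thus ?thesis using k \<open>G k = G k'\<close> by (intro image_eqI[of _ _ k']) auto
      next
        case False
        hence "G k' = p - G (k' - m)" using G_half[of "k' - m"] by simp
        hence "x = int (min (G (k' - m)) (p - G (k' - m)))"
          using k \<open>G k = G k'\<close> G0[of "k' - m"] by linarith
        thus ?thesis using False \<open>k' < 2 * m\<close> by (intro image_eqI[of _ _ "k' - m"]) auto
      qed
    qed
  qed
  thus ?thesis by (simp add: G_def)
qed

lemma sine_product_cubic_class:
  assumes i: "i < 3"
  shows "2 ^ m * sine_product p (cubic_class i) = norm (half_norm i)"
proof -
  define H where "H = half_coset p (cubic_class i)"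
  define f where "f = (\<lambda>k. int (min (g ^ (3 * k + i) mod p) (p - g ^ (3 * k + i) mod p)))"
  have bij: "bij_betw f {..<m} H"
    unfolding f_def H_def by (rule half_coset_bij[OF i])
  have "card H = m" using bij_betw_same_card[OF bij] by simp
  hence "2 ^ m * sine_product p (cubic_class i) = (\<Prod>a\<in>H. 2 * sin (pi * real_of_int a / real p))"
    by (simp add: sine_product_def prod.distrib flip: H_def)
  also have "\<dots> = (\<Prod>k<m. 2 * sin (pi * real_of_int (f k) / real p))"
    by (rule prod.reindex_bij_betw[OF bij, symmetric])
  also have "\<dots> = (\<Prod>k<m. norm (zeta_diff (g ^ (3 * k + i))))"
  proof (intro prod.cong refl)
    fix k
    define r where "r = g ^ (3 * k + i) mod p"
    have r: "r < p" using p_gt_0 by (simp add: r_def)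
    have "sin (pi * real (p - r) / real p) = sin (pi - pi * real r / real p)"
      using r p_gt_0 by (simp add: of_nat_diff field_simps)
    hence "sin (pi * real (p - r) / real p) = sin (pi * real r / real p)" by simp
    hence "2 * sin (pi * real_of_int (f k) / real p) = 2 * sin (pi * real r / real p)"
      by (simp add: f_def min_def flip: r_def)
    also have "\<dots> = norm (zeta_diff r)" using norm_zeta_diff_sin[OF r] by simp
    also have "zeta_diff r = zeta_diff (g ^ (3 * k + i))" by (rule zeta_diff_cong) (simp add: r_def)
    finally show "2 * sin (pi * real_of_int (f k) / real p) = norm (zeta_diff (g ^ (3 * k + i)))" .
  qed
  also have "\<dots> = norm (half_norm i)" by (simp add: half_norm_def prod_norm)
  finally show ?thesis .
qed

text \<open>
  Dividing \<open>|half_norm 0 * half_norm 1 * half_norm 2| = \<surd>p\<close> by the factor that belongs to the coset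
  leaves the absolute value of the product of the other two.
\<close>

lemma nu_in_fixed_field:
  assumes "C \<in> cubic_cosets p" shows "complex_of_real (nu p C) \<in> fixed_field 3"
proof -
  obtain i where i: "i < 3" "C = cubic_class i"
    using cubic_coset_cubic_class[OF assms] .
  have "(p - 1) div 6 = m" by (simp add: p_eq)
  hence nu: "nu p C = norm (half_norm 0 * half_norm 1 * half_norm 2) / norm (half_norm i)"
    unfolding nu_def i(2) norm_prod_half_norm by (simp add: sine_product_cubic_class[OF i(1)])
  have nz: "norm (half_norm j) \<noteq> 0" for j using half_norm_nonzero by simp
  consider "i = 0" | "i = 1" | "i = 2" using i(1) by linarith
  hence "\<exists>k l. nu p C = norm (half_norm k * half_norm l)"
  proof cases
    case 1
    hence "nu p C = norm (half_norm 1 * half_norm 2)" using nz[of 0] by (simp add: nu norm_mult)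
    thus ?thesis by blast
  next
    case 2
    hence "nu p C = norm (half_norm 0 * half_norm 2)" using nz[of 1] by (simp add: nu norm_mult)
    thus ?thesis by blast
  next
    case 3
    hence "nu p C = norm (half_norm 0 * half_norm 1)" using nz[of 2] by (simp add: nu norm_mult)
    thus ?thesis by blast
  qed
  thus ?thesis using norm_half_norm_mult_fixed by metis
qed

end

theorem theorem7p2:
  fixes p :: nat and C :: "nat \<Rightarrow> int set"
  assumes "Factorial_Ring.prime p"
    and "[p = 1] (mod 3)"
    and "bij_betw C {0, 1, 2} (cubic_cosets p)"
  shows "\<forall>j\<in>{0, 1, 2}. complex_of_real (nu p (C j)) \<in> cubic_subfield p"
proof
  fix j :: nat assume j: "j \<in> {0, 1, 2}"
  have p1: "p > 1" using assms(1) prime_gt_1_nat by blast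
  have "p \<noteq> 2" using assms(2) by (auto simp: cong_def)
  hence odd: "odd p" using prime_odd_nat[OF assms(1)] p1 by linarith
  have "p mod 3 = 1" using assms(2) by (simp add: cong_def)
  hence "p mod 6 = 1" using odd by presburger
  hence p: "p = 6 * (p div 6) + 1" by presburger
  obtain g where g: "residue_primroot p g"
    using prime_primitive_root_exists[of p] p1 assms(1) by blast
  interpret cubic_generator p g "p div 6"
    by unfold_locales (fact assms(1) g p)+
  have "6 dvd p - 1" using p by presburger
  moreover have "C j \<in> cubic_cosets p" using assms(3) j by (auto simp: bij_betw_def)
  ultimately show "complex_of_real (nu p (C j)) \<in> cubic_subfield p"
    using nu_in_fixed_field cubic_subfield_eq by simp
qed

end
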